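(* In the setting described in the context (Markov trials, one riskless and $K$ risky assets), with calibrating functions satisfying (q-p), the following assertions hold. (a) Take any sequence $\{\underline C_j,\ j\ge0\}$ obeying (a0)–(a3). Then $\{S_n-A_n,\ n\ge1\}$ is a supermartingale with respect to $(\mathfrak W_n)$; hence $\mathbb E S_n\le\mathbb E A_n$ for all $n\ge1$. (b) To reach equality $\mathbb E S_n=\sum_{j=1}^n\mathbb E\,\alpha_{j-1}(\varepsilon_{j-1})$: the sequence $\{S_n-A_n\}$ is a martingale for a sequence of random vectors $\{\underline C_j\}$ satisfying (a0)–(a3) if and only if the following (i) and (ii) are fulfilled. (i) There exists a map $i\in M\mapsto\underline D(i)=(D^{(1)}(i),\dots,D^{(K)}(i))$ such that for all $i,k\in M$: (i1) $\underline D(i)\ge\underline 0$ and $|\underline D(i)|<1$; (i2) $1+\rho+\underline D(i)\cdot\underline g^*(i,k)\ge b$; (i3) $\sum_{l\in M}\varphi(i,l)p(i,l)\frac{\underline D(i)\cdot\underline g^*(i,l)}{1+\rho+\underline D(i)\cdot\underline g^*(i,l)}=0$; and (i4) the calibrating functions are $q_j(i,k)=\frac{p(i,k)}{1+\rho+\underline D(i)\cdot\underline g^*(i,k)}$, independently of $j\ge0$. (ii) The portfolio vectors $\underline C_j$ have components $C^{(s)}_j(\boldsymbol\varepsilon_0^j)=D^{(s)}(\varepsilon_j)Z_j$, $1\le s\le K$, $j\ge0$. That is, the prescribed fractions of the capital value $Z_j$ are invested in the available returns while the rest is put in the riskless asset. (c) Suppose there exists a map $i\in M\mapsto\underline D(i)=(D^{(1)}(i),\dots,D^{(K)}(i))$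 fulfilling (i1)–(i3). Let $\mathbf D$ stand for the array of values $D^{(s)}(i)$, $i\in M$, $1\le s\le K$, and define $$E_n=E_n(\mathbf D)=\sum_{j=1}^n\beta_{j-1},\qquad\beta_{j-1}=\mathbb E\Big\{\varphi(\varepsilon_{j-1},\varepsilon_j)\ln\big[1+\rho+\underline D(\varepsilon_{j-1})\cdot\underline g^*(\varepsilon_{j-1},\varepsilon_j)\big]\Big\}.$$ Consider the optimization problem: maximise $E_n(\mathbf D)$ subject to (i1)–(i3). Take an optimizer $\mathbf D^*$ (possibly non-unique) and let $E_n^*=E_n(\mathbf D^* )$ denote the optimal value. Then $E^*_n$ defines the maximum of $\mathbb E S_n$ among all portfolios $\{\underline C_j\}$ satisfying (a0)–(a3). The array $\mathbf D^*$, written as a collection of vectors $\underline D^*(i)$, $i\in M$, yields a proportional investment portfolio with $\underline C_j(\boldsymbol\varepsilon_0^j)=\underline D^*(\varepsilon_j)Z_j(\boldsymbol\varepsilon_0^j)$. (d) Suppose there exists a map $i\in M\mapsto\underline D^*(i)$ with all components $D^{*(s)}(i)>0$ fulfilling, in the role of $\underline D$, conditions (i1), (i2) and (i3A) $\sum_{l\in M}p(i,l)\frac{\varphi(i,l)g^{*(s)}(i,l)}{1+\rho+\underline D^*(i)\cdot\underline g^*(i,l)}=0$ for all $i\in M$ and $1\le s\le K$. Then such a map is unique, and the proportional investment portfolio $\underline C^{O}_{j-1}=\underline D^*(\varepsilon_{j-1})Z_{j-1}$ maximises each summand $\beta_{j-1}$ in the expression for $E_n$ in (c). Therefore, it yields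 the maximum of the whole sum $\mathbb E S_n$ among strategies satisfying (a0)–(a2).
   Context: Let $(\varepsilon_n)_{n\ge0}$ be a Markov chain with finite or countable state space $M$ and transition matrix $(p(i,k))_{i,k\in M}$; write $\boldsymbol\varepsilon_0^n=(\varepsilon_0,\dots,\varepsilon_n)$. Let $Z_0>0$ be a random variable (initial capital, possibly dependent on $\varepsilon_0$), $\mathfrak W_0=\sigma(Z_0,\varepsilon_0)$ and $\mathfrak W_n=\mathfrak W_0\vee\sigma(\boldsymbol\varepsilon_0^n)$; the chain is Markov relative to $(\mathfrak W_n)$, i.e. the conditional law of $\varepsilon_n$ given $\mathfrak W_{n-1}$ is $p(\varepsilon_{n-1},\cdot)$. There is a riskless asset with return $g^{(0)}(i,k)=1+\rho$, $\rho>0$, and $K$ risky assets with return functions $g^{(s)}:M\times M\to\mathbb R$, $1\le s\le K$; $\underline g=(g^{(1)},\dots,g^{(K)})$, $g^{*(s)}(i,k)=g^{(s)}(i,k)-(1+\rho)$ and $\underline g^*=(g^{*(1)},\dots,g^{*(K)})$. The weight function is $\varphi:M\times M\to[0,\infty)$. The functions $\underline g$ and $\varphi$ are not identically $0$. Fix $b>0$. Calibrating functions are given functions $q_j:M\times M\to(0,\infty)$. For $\underline u=(u^{(1)},\dots,u^{(K)})$: $|\underline u|=\sum_{s=1}^Ku^{(s)}$; $\underline u\ge\underline0$ means $u^{(s)}\ge0$ for all $s$; $\underline u\cdot\underline v=\sum_su^{(s)}v^{(s)}$. A strategy (portfolio) is a sequence of random $K$-vectors $\underline C_0,\underline C_1,\dots$;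 the capital not invested in risky assets goes to the riskless one, so $$Z_n=(1+\rho)(Z_{n-1}-|\underline C_{n-1}|)+\underline C_{n-1}\cdot\underline g(\varepsilon_{n-1},\varepsilon_n)=Z_{n-1}\Big[1+\rho+\frac{\underline C_{n-1}\cdot\underline g^*(\varepsilon_{n-1},\varepsilon_n)}{Z_{n-1}}\Big],\quad n\ge1.$$ Define $$S_n=\sum_{j=1}^n\varphi(\varepsilon_{j-1},\varepsilon_j)\ln\frac{Z_j}{Z_{j-1}},\qquad \alpha_{j}(i)=\sum_{l\in M}\varphi(i,l)p(i,l)\ln\frac{p(i,l)}{q_{j+1}(i,l)},\qquad A_n=\sum_{j=1}^n\alpha_{j-1}(\varepsilon_{j-1}).$$ All series and expectations involved are assumed to converge absolutely. Conditions on a strategy (for all $j\ge0$): (a0) $\underline C_j$ is $\mathfrak W_j$-measurable; (a1) $\underline C_j\ge\underline0$ and $|\underline C_j|<Z_j$; (a2) $1+\rho+\frac{\underline C_j\cdot\underline g^*(\varepsilon_j,\varepsilon_{j+1})}{Z_j}\ge b$; (a3) $\sum_{l\in M}\varphi(\varepsilon_j,l)q_{j+1}(\varepsilon_j,l)\big[\underline C_j\cdot\underline g^*(\varepsilon_j,l)\big]=0$. Condition on the calibrating functions: (q-p) for all $i\in M$ and all $j\ge0$: $\sum_{l\in M}\varphi(i,l)[(1+\rho)q_j(i,l)-p(i,l)]\le0$.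
   Formalization: In (a),(b), (a2) is also required where p=0; (i4) only where φ>0. "Only if" in (b) assumes all states visited and q_j independent of j, and for (ii) non-redundant assets. In (c), q_j has form (i4) for a feasible D. In (d), D* is unique if assets are non-redundant (else only its returns). *)

theory Defs
  imports "HOL-Probability.Probability"
begin

text \<open>Discrete-time (super)martingales with respect to a filtration of sub-sigma-algebras.\<close>

definition adapted_L1 ::
  "'w measure \<Rightarrow> (nat \<Rightarrow> 'w measure) \<Rightarrow> (nat \<Rightarrow> 'w \<Rightarrow> real) \<Rightarrow> bool" where
  "adapted_L1 M F X \<longleftrightarrow>
     filtration (space M) F \<and> (\<forall>n. subalgebra M (F n)) \<and>
     (\<forall>n. X n \<in> borel_measurable (F n) \<and> integrable M (X n))"

definition supermartingale ::
  "'w measure \<Rightarrow> (nat \<Rightarrow> 'w measure) \<Rightarrow> (nat \<Rightarrow> 'w \<Rightarrow> real) \<Rightarrow> bool" where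
  "supermartingale M F X \<longleftrightarrow> adapted_L1 M F X \<and>
     (\<forall>m n. m \<le> n \<longrightarrow> (AE \<omega> in M. real_cond_exp M (F m) (X n) \<omega> \<le> X m \<omega>))"

definition martingale ::
  "'w measure \<Rightarrow> (nat \<Rightarrow> 'w measure) \<Rightarrow> (nat \<Rightarrow> 'w \<Rightarrow> real) \<Rightarrow> bool" where
  "martingale M F X \<longleftrightarrow> adapted_L1 M F X \<and>
     (\<forall>m n. m \<le> n \<longrightarrow> (AE \<omega> in M. real_cond_exp M (F m) (X n) \<omega> = X m \<omega>))"

text \<open>
  The data of a market.  The state space M is the whole type 'm (countable, possibly finite), and
  'k is the finite index type of the K risky assets.  Calibrating functions and strategies are not
  part of the data: they are arguments q and C of the notions below.
\<close>

record ('w, 'm, 'k) market =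
  prb  :: "'w measure"
  st   :: "nat \<Rightarrow> 'w \<Rightarrow> 'm"              \<comment> \<open>the chain \<open>\<epsilon>\<^sub>n\<close>\<close>
  cap0 :: "'w \<Rightarrow> real"                    \<comment> \<open>the initial capital \<open>Z\<^sub>0\<close>\<close>
  tr   :: "'m \<Rightarrow> 'm \<Rightarrow> real"              \<comment> \<open>the transition matrix \<open>p\<close>\<close>
  ret  :: "'m \<Rightarrow> 'm \<Rightarrow> real ^ 'k"         \<comment> \<open>the returns \<open>g\<close> of the risky assets\<close>
  wgt  :: "'m \<Rightarrow> 'm \<Rightarrow> real"              \<comment> \<open>the weight function \<open>\<phi>\<close>\<close>
  rate :: real                           \<comment> \<open>\<open>\<rho>\<close>; the riskless return is \<open>1 + \<rho>\<close>\<close>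
  lvl  :: real                           \<comment> \<open>the lower bound \<open>b\<close>\<close>

definition info :: "('w, 'm, 'k::finite) market \<Rightarrow> nat \<Rightarrow> 'w measure" where
  "info X n = sigma (space (prb X))
     ({cap0 X -` B \<inter> space (prb X) | B. B \<in> sets borel} \<union>
      {st X j -` B \<inter> space (prb X) | j B. j \<le> n})"

definition markov_market :: "('w, 'm::countable, 'k::finite) market \<Rightarrow> bool" where
  "markov_market X \<longleftrightarrow>
     prob_space (prb X) \<and>
     (\<forall>n. st X n \<in> measurable (prb X) (count_space UNIV)) \<and>
     cap0 X \<in> borel_measurable (prb X) \<and> (AE \<omega> in prb X. cap0 X \<omega> > 0) \<and>
     (\<forall>i k. tr X i k \<ge> 0) \<and> (\<forall>i. (tr X i has_sum 1) UNIV) \<and>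
     (\<forall>n k. AE \<omega> in prb X.
        real_cond_exp (prb X) (info X n) (indicator {\<omega> \<in> space (prb X). st X (Suc n) \<omega> = k}) \<omega>
          = tr X (st X n \<omega>) k) \<and>
     (\<forall>i k. wgt X i k \<ge> 0) \<and> (\<exists>i k. wgt X i k \<noteq> 0) \<and> (\<exists>i k. ret X i k \<noteq> 0) \<and>
     rate X > 0 \<and> lvl X > 0"

definition comp_sum :: "real ^ 'k::finite \<Rightarrow> real" where
  "comp_sum u = (\<Sum>s\<in>UNIV. u $ s)"

definition exret :: "('w, 'm, 'k::finite) market \<Rightarrow> 'm \<Rightarrow> 'm \<Rightarrow> real ^ 'k" where
  "exret X i k = (\<chi> s. ret X i k $ s - (1 + rate X))"

primrec wealth ::
  "('w, 'm, 'k::finite) market \<Rightarrow> (nat \<Rightarrow> 'w \<Rightarrow> real ^ 'k) \<Rightarrow> nat \<Rightarrow> 'w \<Rightarrow> real" where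
  "wealth X C 0 \<omega> = cap0 X \<omega>"
| "wealth X C (Suc n) \<omega> = (1 + rate X) * (wealth X C n \<omega> - comp_sum (C n \<omega>))
     + C n \<omega> \<bullet> ret X (st X n \<omega>) (st X (Suc n) \<omega>)"

definition Sn :: "('w, 'm, 'k::finite) market \<Rightarrow> (nat \<Rightarrow> 'w \<Rightarrow> real ^ 'k) \<Rightarrow> nat \<Rightarrow> 'w \<Rightarrow> real" where
  "Sn X C n \<omega> = (\<Sum>j=1..n. wgt X (st X (j - 1) \<omega>) (st X j \<omega>)
     * ln (wealth X C j \<omega> / wealth X C (j - 1) \<omega>))"

definition alpha ::
  "('w, 'm, 'k::finite) market \<Rightarrow> (nat \<Rightarrow> 'm \<Rightarrow> 'm \<Rightarrow> real) \<Rightarrow> nat \<Rightarrow> 'm \<Rightarrow> real" where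
  "alpha X q j i = (\<Sum>\<^sub>\<infinity>l. wgt X i l * tr X i l * ln (tr X i l / q (Suc j) i l))"

definition An ::
  "('w, 'm, 'k::finite) market \<Rightarrow> (nat \<Rightarrow> 'm \<Rightarrow> 'm \<Rightarrow> real) \<Rightarrow> nat \<Rightarrow> 'w \<Rightarrow> real" where
  "An X q n \<omega> = (\<Sum>j=1..n. alpha X q (j - 1) (st X (j - 1) \<omega>))"

text \<open>
  Calibrating functions satisfying (q-p), including the standing convergence assumptions on the
  series and expectations formed from q alone.  For real-valued families, unordered summability
  is absolute convergence.
\<close>

definition calibrating ::
  "('w, 'm, 'k::finite) market \<Rightarrow> (nat \<Rightarrow> 'm \<Rightarrow> 'm \<Rightarrow> real) \<Rightarrow> bool" where
  "calibrating X q \<longleftrightarrow>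
     (\<forall>j i l. q j i l > 0) \<and>
     (\<forall>j i. (\<lambda>l. wgt X i l * ((1 + rate X) * q j i l - tr X i l)) summable_on UNIV \<and>
            (\<Sum>\<^sub>\<infinity>l. wgt X i l * ((1 + rate X) * q j i l - tr X i l)) \<le> 0) \<and>
     (\<forall>j i. (\<lambda>l. wgt X i l * tr X i l * ln (tr X i l / q (Suc j) i l)) summable_on UNIV) \<and>
     (\<forall>n. integrable (prb X) (An X q n))"

definition a0 :: "('w, 'm, 'k::finite) market \<Rightarrow> (nat \<Rightarrow> 'w \<Rightarrow> real ^ 'k) \<Rightarrow> bool" where
  "a0 X C \<longleftrightarrow> (\<forall>j. C j \<in> borel_measurable (info X j))"

definition a1 :: "('w, 'm, 'k::finite) market \<Rightarrow> (nat \<Rightarrow> 'w \<Rightarrow> real ^ 'k) \<Rightarrow> bool" where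
  "a1 X C \<longleftrightarrow> (\<forall>j. AE \<omega> in prb X. (\<forall>s. C j \<omega> $ s \<ge> 0) \<and> comp_sum (C j \<omega>) < wealth X C j \<omega>)"

definition a2 :: "('w, 'm, 'k::finite) market \<Rightarrow> (nat \<Rightarrow> 'w \<Rightarrow> real ^ 'k) \<Rightarrow> bool" where
  "a2 X C \<longleftrightarrow> (\<forall>j. AE \<omega> in prb X.
     1 + rate X + (C j \<omega> \<bullet> exret X (st X j \<omega>) (st X (Suc j) \<omega>)) / wealth X C j \<omega> \<ge> lvl X)"

text \<open>
  Being an almost sure statement, \<open>a2\<close> says nothing about next states l with p(i,l) = 0, whereas
  (q-p) and \<open>a3\<close> do involve such l.  The next condition requires the inequality of \<open>a2\<close> there
  too, so that it holds for every conceivable next state, as it does when \<open>a2\<close> is read as a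
  statement about all trajectories.  It is void when all p(i,l) > 0.
\<close>

definition a2_null :: "('w, 'm, 'k::finite) market \<Rightarrow> (nat \<Rightarrow> 'w \<Rightarrow> real ^ 'k) \<Rightarrow> bool" where
  "a2_null X C \<longleftrightarrow> (\<forall>j. AE \<omega> in prb X. \<forall>l. tr X (st X j \<omega>) l = 0 \<longrightarrow>
     1 + rate X + (C j \<omega> \<bullet> exret X (st X j \<omega>) l) / wealth X C j \<omega> \<ge> lvl X)"

definition a3 ::
  "('w, 'm, 'k::finite) market \<Rightarrow> (nat \<Rightarrow> 'm \<Rightarrow> 'm \<Rightarrow> real) \<Rightarrow> (nat \<Rightarrow> 'w \<Rightarrow> real ^ 'k) \<Rightarrow> bool" where
  "a3 X q C \<longleftrightarrow> (\<forall>j. AE \<omega> in prb X.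
     ((\<lambda>l. wgt X (st X j \<omega>) l * q (Suc j) (st X j \<omega>) l * (C j \<omega> \<bullet> exret X (st X j \<omega>) l))
        has_sum 0) UNIV)"

definition i1 :: "('w, 'm, 'k::finite) market \<Rightarrow> ('m \<Rightarrow> real ^ 'k) \<Rightarrow> bool" where
  "i1 X D \<longleftrightarrow> (\<forall>i. (\<forall>s. D i $ s \<ge> 0) \<and> comp_sum (D i) < 1)"

definition i2 :: "('w, 'm, 'k::finite) market \<Rightarrow> ('m \<Rightarrow> real ^ 'k) \<Rightarrow> bool" where
  "i2 X D \<longleftrightarrow> (\<forall>i k. 1 + rate X + D i \<bullet> exret X i k \<ge> lvl X)"

definition i3 :: "('w, 'm, 'k::finite) market \<Rightarrow> ('m \<Rightarrow> real ^ 'k) \<Rightarrow> bool" where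
  "i3 X D \<longleftrightarrow> (\<forall>i. ((\<lambda>l. wgt X i l * tr X i l
     * ((D i \<bullet> exret X i l) / (1 + rate X + D i \<bullet> exret X i l))) has_sum 0) UNIV)"

definition i3A :: "('w, 'm, 'k::finite) market \<Rightarrow> ('m \<Rightarrow> real ^ 'k) \<Rightarrow> bool" where
  "i3A X D \<longleftrightarrow> (\<forall>i s. ((\<lambda>l. tr X i l
     * ((wgt X i l * exret X i l $ s) / (1 + rate X + D i \<bullet> exret X i l))) has_sum 0) UNIV)"

text \<open>
  The values of q enter Sn, An, (q-p) and \<open>a3\<close> only through the product with the weight, so the
  formula for q is required exactly at the transitions of positive weight.
\<close>

definition i4 ::
  "('w, 'm, 'k::finite) market \<Rightarrow> ('m \<Rightarrow> real ^ 'k) \<Rightarrow> (nat \<Rightarrow> 'm \<Rightarrow> 'm \<Rightarrow> real) \<Rightarrow> bool" where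
  "i4 X D q \<longleftrightarrow> (\<forall>j i k. wgt X i k > 0 \<longrightarrow>
     q j i k = tr X i k / (1 + rate X + D i \<bullet> exret X i k))"

definition proportional ::
  "('w, 'm, 'k::finite) market \<Rightarrow> ('m \<Rightarrow> real ^ 'k) \<Rightarrow> (nat \<Rightarrow> 'w \<Rightarrow> real ^ 'k) \<Rightarrow> bool" where
  "proportional X D C \<longleftrightarrow>
     (\<forall>j. AE \<omega> in prb X. \<forall>s. C j \<omega> $ s = D (st X j \<omega>) $ s * wealth X C j \<omega>)"

definition log_growth ::
  "('w, 'm, 'k::finite) market \<Rightarrow> ('m \<Rightarrow> real ^ 'k) \<Rightarrow> nat \<Rightarrow> 'w \<Rightarrow> real" where
  "log_growth X D j \<omega> = wgt X (st X j \<omega>) (st X (Suc j) \<omega>)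
     * ln (1 + rate X + D (st X j \<omega>) \<bullet> exret X (st X j \<omega>) (st X (Suc j) \<omega>))"

definition beta :: "('w, 'm, 'k::finite) market \<Rightarrow> ('m \<Rightarrow> real ^ 'k) \<Rightarrow> nat \<Rightarrow> real" where
  "beta X D j = integral\<^sup>L (prb X) (log_growth X D j)"

definition En :: "('w, 'm, 'k::finite) market \<Rightarrow> nat \<Rightarrow> ('m \<Rightarrow> real ^ 'k) \<Rightarrow> real" where
  "En X n D = (\<Sum>j=1..n. beta X D (j - 1))"

text \<open>
  The expectations defining En converge.  (The Bochner integral of a non-integrable function is 0
  by convention, so this cannot be left implicit.)
\<close>

definition En_converges :: "('w, 'm, 'k::finite) market \<Rightarrow> nat \<Rightarrow> ('m \<Rightarrow> real ^ 'k) \<Rightarrow> bool" where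
  "En_converges X n D \<longleftrightarrow> (\<forall>j<n. integrable (prb X) (log_growth X D j))"

definition feasible :: "('w, 'm, 'k::finite) market \<Rightarrow> nat \<Rightarrow> ('m \<Rightarrow> real ^ 'k) \<Rightarrow> bool" where
  "feasible X n D \<longleftrightarrow> i1 X D \<and> i2 X D \<and> i3 X D \<and> En_converges X n D"

definition optimizer :: "('w, 'm, 'k::finite) market \<Rightarrow> nat \<Rightarrow> ('m \<Rightarrow> real ^ 'k) \<Rightarrow> bool" where
  "optimizer X n D \<longleftrightarrow> feasible X n D \<and> (\<forall>D'. feasible X n D' \<longrightarrow> En X n D' \<le> En X n D)"

text \<open>
  No two different portfolios have the same returns along all weighted transitions out of a state.
  Without this, vectors of fractions are determined only up to portfolios of zero excess return.
\<close>

definition nonredundant :: "('w, 'm, 'k::finite) market \<Rightarrow> bool" where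
  "nonredundant X \<longleftrightarrow>
     (\<forall>i v. (\<forall>l. wgt X i l * tr X i l > 0 \<longrightarrow> v \<bullet> exret X i l = 0) \<longrightarrow> v = 0)"

definition all_states_visited :: "('w, 'm, 'k::finite) market \<Rightarrow> bool" where
  "all_states_visited X \<longleftrightarrow>
     (\<forall>i. \<exists>j. measure (prb X) {\<omega> \<in> space (prb X). st X j \<omega> = i} > 0)"

end

theory Submission
  imports Defs
begin

text \<open>
  The one-period growth factor of the capital is
  \<open>growth = 1 + \<rho> + C \<bullet> g\<^sup>* / Z\<close>, and \<open>Z\<^sub>n\<^sub>+\<^sub>1 = Z\<^sub>n * growth\<close>.  Hence every increment of \<open>S\<close> is
  \<open>\<phi> ln growth\<close>, and since the law of the next state given the past is \<open>p(\<epsilon>\<^sub>n, _)\<close>, its conditional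
  expectation is the series \<open>\<Sum>l. \<phi> p ln growth\<close> (\<open>cond_exp_next\<close>).  What remains are
  pointwise estimates of such series, derived from \<open>ln x \<le> x - 1\<close> and its equality case \<open>x = 1\<close>.

  Supermartingale and martingale.  The increment of \<open>A\<close> subtracts \<open>\<Sum>l. \<phi> p ln (p / q)\<close>, so the drift
  of \<open>S - A\<close> is \<open>\<Sum>l. \<phi> p ln (q growth / p)\<close>, which is at most \<open>\<Sum>l. \<phi> (q growth - p)\<close>.  That series
  splits into \<open>\<Sum>l. \<phi> ((1 + \<rho>) q - p) \<le> 0\<close>, by (q-p), and \<open>1 / Z * (\<Sum>l. \<phi> q (C \<bullet> g\<^sup>*)) = 0\<close>, by
  \<open>a3\<close>.  Thus the drift is nonpositive, and it vanishes exactly if the logarithmic inequality is an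
  equality in every term, that is, if \<open>q = p / growth\<close> wherever \<open>\<phi> > 0\<close> (\<open>drift_nonpos\<close>).  For a
  proportional portfolio the growth factor depends on the current and the next state only, which
  turns this criterion into \<open>i4\<close>.  Conversely, if \<open>q\<close> does not depend on time, the fractions
  \<open>C / Z\<close> seen at any one suitable sample point with current state \<open>i\<close> serve as \<open>D(i)\<close>.

  Optimality.  Let \<open>r = 1 + \<rho> + D \<bullet> g\<^sup>*\<close>.  By \<open>ln growth - ln r \<le> (growth - r) / r\<close>, a competing
  strategy cannot beat \<open>D\<close> in conditional mean as soon as \<open>\<Sum>l. \<phi> p (growth - r) / r = 0\<close>
  (\<open>expected_log_mono\<close>).  The numerator is \<open>(C / Z - D) \<bullet> g\<^sup>*\<close>.  If \<open>q = p / r\<close>, its first part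
  contributes \<open>0\<close> by \<open>a3\<close> and the second by \<open>i3\<close>; so the optimal value bounds all strategies that
  are calibrated by some feasible array.  Under \<open>i3A\<close> the sum vanishes for every vector in place of
  \<open>C / Z - D\<close>, so the bound holds without any calibration.  Uniqueness comes from testing the
  conditions \<open>i3A\<close> of two arrays \<open>D\<close> and \<open>D'\<close> on the difference \<open>D - D'\<close> and subtracting: the sum of
  the nonnegative numbers \<open>\<phi> p (r - r')\<^sup>2 / (r r')\<close> is zero.
\<close>

section \<open>Unordered sums of reals\<close>

lemma has_sum_diff:
  fixes f g :: "'a \<Rightarrow> 'b::topological_ab_group_add"
  assumes "(f has_sum a) A" "(g has_sum b) A"
  shows "((\<lambda>x. f x - g x) has_sum (a - b)) A"
  using has_sum_add[OF assms(1), of "\<lambda>x. - g x" "- b"] assms(2) by (simp add: has_sum_uminus)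

lemma has_sum_nn_integral_count_space:
  fixes f :: "'a \<Rightarrow> real"
  assumes "(\<integral>\<^sup>+x. ennreal (f x) \<partial>count_space A) < \<infinity>" "\<And>x. f x \<ge> 0"
  shows "(f has_sum enn2real (\<integral>\<^sup>+x. ennreal (f x) \<partial>count_space A)) A"
proof -
  have "integrable (count_space A) f"
    using assms by (intro integrableI_nonneg) auto
  then have s: "Infinite_Set_Sum.abs_summable_on f A"
    by (simp add: Infinite_Set_Sum.abs_summable_on_def)
  then have "f summable_on A"
    using abs_summable_equivalent abs_summable_summable by blast
  moreover have "enn2real (\<integral>\<^sup>+x. ennreal (f x) \<partial>count_space A) = infsum f A"
    using integral_eq_nn_integral[of f "count_space A"] assms(2) infsetsum_infsum[OF s]
    by (simp add: infsetsum_def)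
  ultimately show ?thesis by simp
qed

text \<open>
  The second part is the equality case: a family with sum \<open>0\<close> below one with sum at most \<open>0\<close> leaves
  no room for a strict inequality in any term.
\<close>

lemma has_sum_nonpos_by_majorant:
  fixes f h :: "'a \<Rightarrow> real"
  assumes f: "(f has_sum a) A" and h: "(h has_sum b) A" "b \<le> 0" and le: "\<And>x. x \<in> A \<Longrightarrow> f x \<le> h x"
  shows "a \<le> 0" "a = 0 \<Longrightarrow> x \<in> A \<Longrightarrow> f x = h x"
proof -
  show "a \<le> 0" using has_sum_mono[OF f h(1) le] h(2) by linarith
  show "f x = h x" if "a = 0" "x \<in> A"
  proof (rule ccontr)
    assume "f x \<noteq> h x"
    then have "f x < h x" using le[OF that(2)] by simp
    from has_sum_strict_mono[OF f h(1) le that(2) this] show False using h(2) that by simp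
  qed
qed

section \<open>Supermartingales from one-step increments\<close>

text \<open>
  The tower property carries the one-step inequality over to all pairs of times \<open>m \<le> n\<close>.
\<close>

lemma supermartingale_if_increments:
  assumes F: "\<And>n. sigma_finite_subalgebra M (F n)"
    and Y: "adapted_L1 M F Y"
    and inc: "\<And>n. AE \<omega> in M. real_cond_exp M (F n) (\<lambda>\<omega>. Y (Suc n) \<omega> - Y n \<omega>) \<omega> \<le> 0"
  shows "supermartingale M F Y"
proof -
  have int: "integrable M (Y n)" and meas: "Y n \<in> borel_measurable (F n)"
    and sub: "subalgebra M (F n)" for n
    using Y unfolding adapted_L1_def by auto
  have mono: "subalgebra (F n) (F m)" if "m \<le> n" for m n
    using Y that filtration.sets_F_mono[of _ F] filtration.space_F[of _ F]
    unfolding adapted_L1_def subalgebra_def by metis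
  have "AE \<omega> in M. real_cond_exp M (F m) (Y n) \<omega> \<le> Y m \<omega>" if "m \<le> n" for m n
    using that
  proof (induction rule: dec_induct)
    case base
    show ?case using sigma_finite_subalgebra.real_cond_exp_F_meas[OF F int meas, of m] by eventually_elim simp
  next
    case (step n)
    interpret m: sigma_finite_subalgebra M "F m" by (rule F)
    interpret n: sigma_finite_subalgebra M "F n" by (rule F)
    have "AE \<omega> in M. real_cond_exp M (F n) (Y (Suc n)) \<omega> \<le> Y n \<omega>"
      using n.real_cond_exp_diff[OF int int, of "Suc n" n] n.real_cond_exp_F_meas[OF int meas] inc[of n]
      by eventually_elim simp
    then have "AE \<omega> in M. real_cond_exp M (F m) (real_cond_exp M (F n) (Y (Suc n))) \<omega>
        \<le> real_cond_exp M (F m) (Y n) \<omega>"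
      by (intro m.real_cond_exp_mono) (auto intro: int n.real_cond_exp_int(1))
    with m.real_cond_exp_nested_subalg[OF sub mono[OF step(1)] int, of "Suc n"] step.IH
    show ?case by eventually_elim simp
  qed
  with Y show ?thesis by (simp add: supermartingale_def)
qed

text \<open>
  From right to left, both the process and its negative are supermartingales.
\<close>

lemma martingale_iff_increments:
  assumes F: "\<And>n. sigma_finite_subalgebra M (F n)"
    and Y: "adapted_L1 M F Y"
  shows "martingale M F Y \<longleftrightarrow>
    (\<forall>n. AE \<omega> in M. real_cond_exp M (F n) (\<lambda>\<omega>. Y (Suc n) \<omega> - Y n \<omega>) \<omega> = 0)"
proof -
  have int: "integrable M (Y n)" and meas: "Y n \<in> borel_measurable (F n)" for n
    using Y unfolding adapted_L1_def by auto
  have inc: "AE \<omega> in M. real_cond_exp M (F n) (\<lambda>\<omega>. Y (Suc n) \<omega> - Y n \<omega>) \<omega>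
      = real_cond_exp M (F n) (Y (Suc n)) \<omega> - Y n \<omega>" for n
    using sigma_finite_subalgebra.real_cond_exp_diff[OF F int int, of n "Suc n" n]
      sigma_finite_subalgebra.real_cond_exp_F_meas[OF F int meas, of n]
    by eventually_elim simp
  show ?thesis
  proof
    assume mart: "martingale M F Y"
    show "\<forall>n. AE \<omega> in M. real_cond_exp M (F n) (\<lambda>\<omega>. Y (Suc n) \<omega> - Y n \<omega>) \<omega> = 0"
    proof
      fix n
      have "AE \<omega> in M. real_cond_exp M (F n) (Y (Suc n)) \<omega> = Y n \<omega>"
        using mart unfolding martingale_def by simp
      with inc[of n] show "AE \<omega> in M. real_cond_exp M (F n) (\<lambda>\<omega>. Y (Suc n) \<omega> - Y n \<omega>) \<omega> = 0"
        by eventually_elim simp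
    qed
  next
    assume zero: "\<forall>n. AE \<omega> in M. real_cond_exp M (F n) (\<lambda>\<omega>. Y (Suc n) \<omega> - Y n \<omega>) \<omega> = 0"
    let ?N = "\<lambda>n \<omega>. - Y n \<omega>"
    have neg: "AE \<omega> in M. real_cond_exp M (F n) (\<lambda>\<omega>. - f \<omega>) \<omega> = - real_cond_exp M (F n) f \<omega>"
      if "integrable M f" for f n
      using sigma_finite_subalgebra.real_cond_exp_cmult[OF F that, of n "-1"] by simp
    have "supermartingale M F Y"
      using zero by (intro supermartingale_if_increments[OF F Y]) (blast intro: eventually_mono order_eq_refl)
    moreover have "supermartingale M F ?N"
    proof (rule supermartingale_if_increments[OF F])
      show "adapted_L1 M F ?N" using Y unfolding adapted_L1_def by auto
      fix n
      have "AE \<omega> in M. real_cond_exp M (F n) (\<lambda>\<omega>. - (Y (Suc n) \<omega> - Y n \<omega>)) \<omega> = 0"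
        using neg[of "\<lambda>\<omega>. Y (Suc n) \<omega> - Y n \<omega>" n] zero[rule_format, of n] int by auto
      then show "AE \<omega> in M. real_cond_exp M (F n) (\<lambda>\<omega>. ?N (Suc n) \<omega> - ?N n \<omega>) \<omega> \<le> 0"
        by (auto elim: eventually_mono)
    qed
    ultimately have "AE \<omega> in M. real_cond_exp M (F m) (Y n) \<omega> = Y m \<omega>" if "m \<le> n" for m n
    proof -
      assume sup: "supermartingale M F Y" "supermartingale M F ?N"
      have "AE \<omega> in M. real_cond_exp M (F m) (Y n) \<omega> \<le> Y m \<omega>"
        "AE \<omega> in M. real_cond_exp M (F m) (?N n) \<omega> \<le> ?N m \<omega>"
        using sup that unfolding supermartingale_def by blast+
      with neg[OF int[of n], of m] show ?thesis by eventually_elim simp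
    qed
    with Y show "martingale M F Y" by (simp add: martingale_def)
  qed
qed

section \<open>The information filtration and the law of the next state\<close>

locale market_model =
  fixes X :: "('w, 'm::countable, 'k::finite) market"
  assumes market: "markov_market X"

sublocale market_model \<subseteq> prob_space "prb X"
  using market unfolding markov_market_def by blast

context market_model
begin

lemma
  shows st_measurable_prb [measurable]: "st X n \<in> measurable (prb X) (count_space UNIV)"
    and cap0_measurable_prb [measurable]: "cap0 X \<in> borel_measurable (prb X)"
    and cap0_pos: "AE \<omega> in prb X. cap0 X \<omega> > 0"
    and tr_nonneg: "tr X i k \<ge> 0"
    and wgt_nonneg: "wgt X i k \<ge> 0"
    and rate_pos: "rate X > 0"
    and lvl_pos: "lvl X > 0"
    and markov: "AE \<omega> in prb X.
        real_cond_exp (prb X) (info X n) (indicator {\<omega> \<in> space (prb X). st X (Suc n) \<omega> = k}) \<omega>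
          = tr X (st X n \<omega>) k"
  using market unfolding markov_market_def by blast+

lemma space_info [simp]: "space (info X n) = space (prb X)"
  unfolding info_def by (rule space_measure_of) auto

lemma sets_info:
  "sets (info X n) = sigma_sets (space (prb X))
     ({cap0 X -` B \<inter> space (prb X) | B. B \<in> sets borel} \<union>
      {st X j -` B \<inter> space (prb X) | j B. j \<le> n})"
  unfolding info_def by (rule sets_measure_of) auto

lemma cap0_measurable_info [measurable]: "cap0 X \<in> borel_measurable (info X n)"
  by (rule measurableI) (auto simp: sets_info intro!: sigma_sets.Basic)

lemma st_measurable_info: "j \<le> n \<Longrightarrow> st X j \<in> measurable (info X n) (count_space UNIV)"
  by (rule measurableI) (auto simp: sets_info intro!: sigma_sets.Basic)

lemma st_measurable_info_now [measurable]: "st X n \<in> measurable (info X n) (count_space UNIV)"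
  by (rule st_measurable_info) simp

lemma sets_info_mono: "m \<le> n \<Longrightarrow> sets (info X m) \<subseteq> sets (info X n)"
  unfolding sets_info by (rule sigma_sets_mono') (auto intro: order_trans)

lemma subalgebra_info_mono: "m \<le> n \<Longrightarrow> subalgebra (info X n) (info X m)"
  using sets_info_mono by (simp add: subalgebra_def)

lemma subalgebra_info: "subalgebra (prb X) (info X n)"
proof -
  have "sets (info X n) \<subseteq> sets (prb X)"
    unfolding sets_info
    by (rule sets.sigma_sets_subset) (auto intro: measurable_sets[OF cap0_measurable_prb]
        measurable_sets[OF st_measurable_prb])
  then show ?thesis by (simp add: subalgebra_def)
qed

lemma filtration_info: "filtration (space (prb X)) (info X)"
  using sets_info_mono by unfold_locales auto

lemma measurable_info_mono:
  "f \<in> measurable (info X m) N \<Longrightarrow> m \<le> n \<Longrightarrow> f \<in> measurable (info X n) N"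
  using measurable_from_subalg[OF subalgebra_info_mono] by blast

lemma measurable_info_prb: "f \<in> measurable (info X m) N \<Longrightarrow> f \<in> measurable (prb X) N"
  using measurable_from_subalg[OF subalgebra_info] by blast

lemma cond_exp_info: "sigma_finite_subalgebra (prb X) (info X n)"
proof -
  have "finite_measure_subalgebra (prb X) (info X n)"
    by unfold_locales (rule subalgebra_info)
  then show ?thesis by (rule finite_measure_subalgebra_is_sigma_finite)
qed

lemma borel_measurable_next:
  assumes U: "\<And>l. (\<lambda>\<omega>. U \<omega> l) \<in> borel_measurable (info X n)"
  shows "(\<lambda>\<omega>. U \<omega> (st X (Suc n) \<omega>)) \<in> borel_measurable (info X (Suc n))"
  using measurable_compose_countable[where f="\<lambda>l \<omega>. U \<omega> l" and g="st X (Suc n)"]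
    measurable_info_mono[OF U, of "Suc n"] by simp

text \<open>
  The Markov property in weak form, for test functions of the past; nonnegative integrals let it be
  summed over all next states without regard to convergence.
\<close>

lemma transition_nn_integral:
  assumes [measurable]: "h \<in> borel_measurable (info X n)"
  shows "(\<integral>\<^sup>+\<omega>. h \<omega> * indicator {\<omega>. st X (Suc n) \<omega> = k} \<omega> \<partial>prb X)
       = (\<integral>\<^sup>+\<omega>. h \<omega> * ennreal (tr X (st X n \<omega>) k) \<partial>prb X)"
proof -
  interpret F: sigma_finite_subalgebra "prb X" "info X n" by (rule cond_exp_info)
  let ?E = "{\<omega> \<in> space (prb X). st X (Suc n) \<omega> = k}"
  let ?c = "nn_cond_exp (prb X) (info X n)"
  have E [measurable]: "?E \<in> sets (prb X)" by measurable
  have "AE \<omega> in prb X. ennreal (tr X (st X n \<omega>) k) = ?c (indicator ?E) \<omega>"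
  proof (rule F.nn_cond_exp_charact)
    fix A assume A [measurable]: "A \<in> sets (info X n)"
    have A' [measurable]: "A \<in> sets (prb X)" using A subalgebra_info[of n] by (auto simp: subalgebra_def)
    have int: "integrable (prb X) (indicator ?E :: _ \<Rightarrow> real)"
      by (simp add: emeasure_eq_measure)
    have t [measurable]: "(\<lambda>\<omega>. tr X (st X n \<omega>) k) \<in> borel_measurable (prb X)" by measurable
    have cint: "integrable (prb X) (\<lambda>\<omega>. tr X (st X n \<omega>) k)"
      using F.real_cond_exp_int(1)[OF int] markov[of n k] by (subst integrable_cong_AE) (auto elim: AE_mp)
    have "(\<integral>\<^sup>+\<omega>\<in>A. indicator ?E \<omega> \<partial>prb X) = (\<integral>\<^sup>+\<omega>. ennreal (indicator A \<omega> * indicator ?E \<omega>) \<partial>prb X)"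
      by (intro nn_integral_cong) (auto split: split_indicator)
    also have "\<dots> = ennreal (\<integral>\<omega>\<in>A. indicator ?E \<omega> \<partial>prb X)"
      unfolding set_lebesgue_integral_def
      using integrable_mult_indicator[OF A' int] by (subst nn_integral_eq_integral) auto
    also have "(\<integral>\<omega>\<in>A. indicator ?E \<omega> \<partial>prb X) = (\<integral>\<omega>\<in>A. tr X (st X n \<omega>) k \<partial>prb X)"
      unfolding F.real_cond_exp_intA[OF int A] unfolding set_lebesgue_integral_def
      using markov[of n k] measurable_info_prb[OF borel_measurable_cond_exp]
      by (intro integral_cong_AE) auto
    also have "ennreal \<dots> = (\<integral>\<^sup>+\<omega>. ennreal (indicator A \<omega> * tr X (st X n \<omega>) k) \<partial>prb X)"
      unfolding set_lebesgue_integral_def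
      using integrable_mult_indicator[OF A' cint] by (subst nn_integral_eq_integral) (auto simp: tr_nonneg)
    also have "\<dots> = (\<integral>\<^sup>+\<omega>\<in>A. ennreal (tr X (st X n \<omega>) k) \<partial>prb X)"
      by (intro nn_integral_cong) (auto split: split_indicator)
    finally show "(\<integral>\<^sup>+\<omega>\<in>A. indicator ?E \<omega> \<partial>prb X) = (\<integral>\<^sup>+\<omega>\<in>A. ennreal (tr X (st X n \<omega>) k) \<partial>prb X)" .
  qed measurable
  then have "(\<integral>\<^sup>+\<omega>. h \<omega> * ennreal (tr X (st X n \<omega>) k) \<partial>prb X) = (\<integral>\<^sup>+\<omega>. h \<omega> * ?c (indicator ?E) \<omega> \<partial>prb X)"
    by (intro nn_integral_cong_AE) auto
  also have "\<dots> = (\<integral>\<^sup>+\<omega>. h \<omega> * indicator ?E \<omega> \<partial>prb X)"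
    by (rule F.nn_cond_exp_intg) measurable
  also have "\<dots> = (\<integral>\<^sup>+\<omega>. h \<omega> * indicator {\<omega>. st X (Suc n) \<omega> = k} \<omega> \<partial>prb X)"
    by (intro nn_integral_cong) (auto split: split_indicator)
  finally show ?thesis by simp
qed

text \<open>
  Decompose according to the value of the next state and exchange sum and integral.
\<close>

lemma nn_integral_next:
  fixes U :: "'w \<Rightarrow> 'm \<Rightarrow> ennreal"
  assumes U [measurable]: "\<And>l. (\<lambda>\<omega>. U \<omega> l) \<in> borel_measurable (info X n)"
  shows "(\<integral>\<^sup>+\<omega>. U \<omega> (st X (Suc n) \<omega>) \<partial>prb X)
       = (\<integral>\<^sup>+\<omega>. \<integral>\<^sup>+l. U \<omega> l * ennreal (tr X (st X n \<omega>) l) \<partial>count_space UNIV \<partial>prb X)"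
proof -
  have [measurable]: "(\<lambda>\<omega>. U \<omega> l) \<in> borel_measurable (prb X)" for l
    by (rule measurable_info_prb[OF U])
  have "(\<integral>\<^sup>+\<omega>. U \<omega> (st X (Suc n) \<omega>) \<partial>prb X)
      = (\<integral>\<^sup>+\<omega>. \<integral>\<^sup>+l. U \<omega> l * indicator {\<omega>. st X (Suc n) \<omega> = l} \<omega> \<partial>count_space UNIV \<partial>prb X)"
  proof (rule nn_integral_cong)
    fix \<omega>
    have "(\<integral>\<^sup>+l. U \<omega> l * indicator {\<omega>. st X (Suc n) \<omega> = l} \<omega> \<partial>count_space UNIV)
        = (\<integral>\<^sup>+l. U \<omega> (st X (Suc n) \<omega>) * indicator {st X (Suc n) \<omega>} l \<partial>count_space UNIV)"
      by (intro nn_integral_cong) (auto split: split_indicator)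
    then show "U \<omega> (st X (Suc n) \<omega>) = (\<integral>\<^sup>+l. U \<omega> l * indicator {\<omega>. st X (Suc n) \<omega> = l} \<omega> \<partial>count_space UNIV)"
      by (simp add: nn_integral_cmult)
  qed
  also have "\<dots> = (\<integral>\<^sup>+l. \<integral>\<^sup>+\<omega>. U \<omega> l * indicator {\<omega>. st X (Suc n) \<omega> = l} \<omega> \<partial>prb X \<partial>count_space UNIV)"
    by (rule nn_integral_count_space_nn_integral) (auto intro!: borel_measurable_times_ennreal)
  also have "\<dots> = (\<integral>\<^sup>+l. \<integral>\<^sup>+\<omega>. U \<omega> l * ennreal (tr X (st X n \<omega>) l) \<partial>prb X \<partial>count_space UNIV)"
    by (simp add: transition_nn_integral)
  also have "\<dots> = (\<integral>\<^sup>+\<omega>. \<integral>\<^sup>+l. U \<omega> l * ennreal (tr X (st X n \<omega>) l) \<partial>count_space UNIV \<partial>prb X)"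
    by (rule nn_integral_count_space_nn_integral[symmetric]) auto
  finally show ?thesis .
qed

text \<open>
  Only possible transitions are seen by an almost sure statement about the next state, and all of
  them are: each has positive conditional probability.
\<close>

lemma AE_next:
  assumes P: "AE \<omega> in prb X. P \<omega> (st X (Suc n) \<omega>)"
    and [measurable]: "\<And>l. Measurable.pred (info X n) (\<lambda>\<omega>. P \<omega> l)"
  shows "AE \<omega> in prb X. \<forall>l. tr X (st X n \<omega>) l > 0 \<longrightarrow> P \<omega> l"
proof -
  \<comment> \<open>Testing the Markov property with the indicator of failure shows that failure and positive
    transition probability almost surely exclude each other.\<close>
  let ?U = "\<lambda>\<omega> l. if P \<omega> l then 0 else (1::ennreal)"
  have [measurable]: "Measurable.pred (prb X) (\<lambda>\<omega>. P \<omega> l)" for l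
    by (rule measurable_info_prb) measurable
  have "AE \<omega> in prb X. tr X (st X n \<omega>) l > 0 \<longrightarrow> P \<omega> l" for l
  proof -
    have "(\<integral>\<^sup>+\<omega>. ?U \<omega> l * ennreal (tr X (st X n \<omega>) l) \<partial>prb X)
        = (\<integral>\<^sup>+\<omega>. ?U \<omega> l * indicator {\<omega>. st X (Suc n) \<omega> = l} \<omega> \<partial>prb X)"
      by (rule transition_nn_integral[symmetric]) measurable
    also have "\<dots> = (\<integral>\<^sup>+\<omega>. 0 \<partial>prb X)"
      using P by (intro nn_integral_cong_AE) (auto split: split_indicator)
    finally have "AE \<omega> in prb X. ?U \<omega> l * ennreal (tr X (st X n \<omega>) l) = 0"
      by (simp add: nn_integral_0_iff_AE)
    then show ?thesis by eventually_elim (auto split: if_splits simp: ennreal_eq_0_iff)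
  qed
  then show ?thesis by (simp add: AE_all_countable)
qed

lemma nn_cond_exp_next:
  fixes U :: "'w \<Rightarrow> 'm \<Rightarrow> ennreal"
  assumes U [measurable]: "\<And>l. (\<lambda>\<omega>. U \<omega> l) \<in> borel_measurable (info X n)"
  shows "AE \<omega> in prb X. (\<integral>\<^sup>+l. U \<omega> l * ennreal (tr X (st X n \<omega>) l) \<partial>count_space UNIV)
     = nn_cond_exp (prb X) (info X n) (\<lambda>\<omega>. U \<omega> (st X (Suc n) \<omega>)) \<omega>"
proof (rule sigma_finite_subalgebra.nn_cond_exp_charact[OF cond_exp_info])
  fix A assume A [measurable]: "A \<in> sets (info X n)"
  show "(\<integral>\<^sup>+\<omega>\<in>A. U \<omega> (st X (Suc n) \<omega>) \<partial>prb X)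
    = (\<integral>\<^sup>+\<omega>\<in>A. (\<integral>\<^sup>+l. U \<omega> l * ennreal (tr X (st X n \<omega>) l) \<partial>count_space UNIV) \<partial>prb X)"
    \<comment> \<open>An event of the past can be absorbed into the integrand.\<close>
    using nn_integral_next[where U="\<lambda>\<omega> l. U \<omega> l * indicator A \<omega>" and n=n]
    by (simp add: nn_integral_cmult[symmetric] nn_integral_multc[symmetric] mult_ac)
next
  show "(\<lambda>\<omega>. U \<omega> (st X (Suc n) \<omega>)) \<in> borel_measurable (prb X)"
    by (intro measurable_info_prb[OF borel_measurable_next] U)
next
  have "case_prod (\<lambda>\<omega> l. U \<omega> l * ennreal (tr X (st X n \<omega>) l))
      \<in> borel_measurable (info X n \<Otimes>\<^sub>M count_space UNIV)"
    using measurable_compose_countable[where g=snd and M="info X n \<Otimes>\<^sub>M count_space UNIV"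
        and f="\<lambda>l z. U (fst z) l * ennreal (tr X (st X n (fst z)) l)"]
    by (simp add: case_prod_beta')
  then show "(\<lambda>\<omega>. \<integral>\<^sup>+l. U \<omega> l * ennreal (tr X (st X n \<omega>) l) \<partial>count_space UNIV)
      \<in> borel_measurable (info X n)"
    by (rule sigma_finite_measure.borel_measurable_nn_integral[OF sigma_finite_measure_count_space])
qed

lemma cond_exp_next_nonneg:
  fixes U :: "'w \<Rightarrow> 'm \<Rightarrow> real"
  assumes U [measurable]: "\<And>l. (\<lambda>\<omega>. U \<omega> l) \<in> borel_measurable (info X n)"
    and nonneg: "\<And>\<omega> l. U \<omega> l \<ge> 0"
    and int: "integrable (prb X) (\<lambda>\<omega>. U \<omega> (st X (Suc n) \<omega>))"
  shows "AE \<omega> in prb X. ((\<lambda>l. tr X (st X n \<omega>) l * U \<omega> l) has_sum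
     real_cond_exp (prb X) (info X n) (\<lambda>\<omega>. U \<omega> (st X (Suc n) \<omega>)) \<omega>) UNIV"
proof -
  interpret F: sigma_finite_subalgebra "prb X" "info X n" by (rule cond_exp_info)
  let ?f = "\<lambda>\<omega>. U \<omega> (st X (Suc n) \<omega>)"
  let ?c = "nn_cond_exp (prb X) (info X n)"
  have c: "AE \<omega> in prb X. (\<integral>\<^sup>+l. ennreal (tr X (st X n \<omega>) l * U \<omega> l) \<partial>count_space UNIV) = ?c ?f \<omega>"
    using nn_cond_exp_next[where U="\<lambda>\<omega> l. ennreal (U \<omega> l)" and n=n]
    by (simp add: ennreal_mult nonneg tr_nonneg mult.commute)
  have "(\<integral>\<^sup>+\<omega>. ?c ?f \<omega> \<partial>prb X) = (\<integral>\<^sup>+\<omega>. ?f \<omega> \<partial>prb X)"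
    using F.nn_cond_exp_intg[of "\<lambda>_. 1" "\<lambda>\<omega>. ennreal (?f \<omega>)"] borel_measurable_integrable[OF int] by simp
  also have "\<dots> < \<infinity>"
    using int nonneg by (simp add: nn_integral_eq_integral)
  finally have fin: "AE \<omega> in prb X. ?c ?f \<omega> \<noteq> \<infinity>"
    by (intro nn_integral_PInf_AE) (auto simp: measurable_info_prb[OF borel_measurable_nn_cond_exp])
  have "(\<lambda>x. ennreal (- ?f x)) = (\<lambda>x. 0)" by (auto simp: ennreal_neg nonneg)
  moreover have "AE \<omega> in prb X. 0 = ?c (\<lambda>x. 0) \<omega>"
    by (rule F.nn_cond_exp_F_meas) simp
  ultimately have "AE \<omega> in prb X. ?c (\<lambda>x. ennreal (- ?f x)) \<omega> = 0" by auto
  with c fin show ?thesis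
  proof eventually_elim
    case (elim \<omega>)
    let ?g = "\<lambda>l. tr X (st X n \<omega>) l * U \<omega> l"
    have "(\<integral>\<^sup>+l. ennreal (?g l) \<partial>count_space UNIV) < \<infinity>"
      using elim by (simp add: less_top)
    from has_sum_nn_integral_count_space[OF this] show ?case
      using elim by (simp add: real_cond_exp_def nonneg tr_nonneg)
  qed
qed

text \<open>
  Stating the conditional expectation as the value of an unordered sum includes the absolute
  convergence of the series, almost surely.
\<close>

lemma cond_exp_next:
  fixes U :: "'w \<Rightarrow> 'm \<Rightarrow> real"
  assumes U [measurable]: "\<And>l. (\<lambda>\<omega>. U \<omega> l) \<in> borel_measurable (info X n)"
    and int: "integrable (prb X) (\<lambda>\<omega>. U \<omega> (st X (Suc n) \<omega>))"
  shows "AE \<omega> in prb X. ((\<lambda>l. tr X (st X n \<omega>) l * U \<omega> l) has_sum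
     real_cond_exp (prb X) (info X n) (\<lambda>\<omega>. U \<omega> (st X (Suc n) \<omega>)) \<omega>) UNIV"
proof -
  interpret F: sigma_finite_subalgebra "prb X" "info X n" by (rule cond_exp_info)
  let ?p = "\<lambda>\<omega> l. max (U \<omega> l) 0" and ?m = "\<lambda>\<omega> l. max (- U \<omega> l) 0"
  have split: "?p \<omega> l - ?m \<omega> l = U \<omega> l" for \<omega> l by (auto simp: max_def)
  have ip: "integrable (prb X) (\<lambda>\<omega>. ?p \<omega> (st X (Suc n) \<omega>))"
    and im: "integrable (prb X) (\<lambda>\<omega>. ?m \<omega> (st X (Suc n) \<omega>))"
    using int by auto
  have "AE \<omega> in prb X. real_cond_exp (prb X) (info X n)
      (\<lambda>\<omega>. ?p \<omega> (st X (Suc n) \<omega>) - ?m \<omega> (st X (Suc n) \<omega>)) \<omega>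
    = real_cond_exp (prb X) (info X n) (\<lambda>\<omega>. ?p \<omega> (st X (Suc n) \<omega>)) \<omega>
    - real_cond_exp (prb X) (info X n) (\<lambda>\<omega>. ?m \<omega> (st X (Suc n) \<omega>)) \<omega>"
    by (rule F.real_cond_exp_diff[OF ip im])
  moreover have "AE \<omega> in prb X. ((\<lambda>l. tr X (st X n \<omega>) l * ?p \<omega> l) has_sum
     real_cond_exp (prb X) (info X n) (\<lambda>\<omega>. ?p \<omega> (st X (Suc n) \<omega>)) \<omega>) UNIV"
    by (rule cond_exp_next_nonneg[where U="?p", OF _ _ ip]) auto
  moreover have "AE \<omega> in prb X. ((\<lambda>l. tr X (st X n \<omega>) l * ?m \<omega> l) has_sum
     real_cond_exp (prb X) (info X n) (\<lambda>\<omega>. ?m \<omega> (st X (Suc n) \<omega>)) \<omega>) UNIV"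
    by (rule cond_exp_next_nonneg[where U="?m", OF _ _ im]) auto
  ultimately show ?thesis
  proof eventually_elim
    case (elim \<omega>)
    let ?P = "\<lambda>l. tr X (st X n \<omega>) l * ?p \<omega> l" and ?M = "\<lambda>l. tr X (st X n \<omega>) l * ?m \<omega> l"
    have "(\<lambda>l. ?P l - ?M l) = (\<lambda>l. tr X (st X n \<omega>) l * U \<omega> l)"
      by (simp only: right_diff_distrib[symmetric] split)
    then show ?case
      using elim has_sum_diff[of ?P UNIV _ ?M] split by simp
  qed
qed

end

section \<open>One-period growth of the capital\<close>

text \<open>
  The next state is an argument \<open>l\<close> of its own, since the conditional expectations, (q-p) and \<open>a3\<close> sum
  over all states that might come next.
\<close>

definition growth ::
  "('w, 'm, 'k::finite) market \<Rightarrow> (nat \<Rightarrow> 'w \<Rightarrow> real ^ 'k) \<Rightarrow> nat \<Rightarrow> 'w \<Rightarrow> 'm \<Rightarrow> real" where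
  "growth X C j \<omega> l = 1 + rate X + (C j \<omega> \<bullet> exret X (st X j \<omega>) l) / wealth X C j \<omega>"

lemma inner_ret: "u \<bullet> ret X i l = (1 + rate X) * comp_sum u + u \<bullet> exret X i l"
  by (simp add: inner_vec_def comp_sum_def exret_def right_diff_distrib sum_subtractf
      sum_distrib_left mult.commute)

lemma wealth_Suc_growth:
  "wealth X C n \<omega> \<noteq> 0 \<Longrightarrow> wealth X C (Suc n) \<omega> = wealth X C n \<omega> * growth X C n \<omega> (st X (Suc n) \<omega>)"
  by (simp add: inner_ret growth_def field_simps)

lemma Sn_Suc:
  assumes "wealth X C n \<omega> \<noteq> 0"
  shows "Sn X C (Suc n) \<omega>
    = Sn X C n \<omega> + wgt X (st X n \<omega>) (st X (Suc n) \<omega>) * ln (growth X C n \<omega> (st X (Suc n) \<omega>))"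
  using assms by (simp add: Sn_def wealth_Suc_growth del: wealth.simps)

lemma An_Suc: "An X q (Suc n) \<omega> = An X q n \<omega> + alpha X q n (st X n \<omega>)"
  by (simp add: An_def)

context market_model
begin

lemma wealth_measurable:
  assumes "a0 X C"
  shows "wealth X C n \<in> borel_measurable (info X n)"
proof (induction n)
  case 0
  have "wealth X C 0 = cap0 X" by (rule ext) simp
  then show ?case by simp
next
  case (Suc n)
  have [measurable]: "C n \<in> borel_measurable (info X (Suc n))"
    using assms measurable_info_mono[of "C n" n borel "Suc n"] by (simp add: a0_def)
  have [measurable]: "wealth X C n \<in> borel_measurable (info X (Suc n))"
    using Suc measurable_info_mono[of _ n borel "Suc n"] by simp
  have [measurable]: "(\<lambda>\<omega>. ret X (st X n \<omega>) (st X (Suc n) \<omega>)) \<in> borel_measurable (info X (Suc n))"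
    by (rule borel_measurable_next) measurable
  have [measurable]: "(\<lambda>\<omega>. comp_sum (C n \<omega>)) \<in> borel_measurable (info X (Suc n))"
    unfolding comp_sum_def cart_eq_inner_axis by measurable
  have "wealth X C (Suc n) = (\<lambda>\<omega>. (1 + rate X) * (wealth X C n \<omega> - comp_sum (C n \<omega>))
     + C n \<omega> \<bullet> ret X (st X n \<omega>) (st X (Suc n) \<omega>))"
    by (rule ext) simp
  then show ?case by simp
qed

lemma growth_measurable:
  assumes "a0 X C"
  shows "(\<lambda>\<omega>. growth X C n \<omega> l) \<in> borel_measurable (info X n)"
proof -
  have [measurable]: "C n \<in> borel_measurable (info X n)" using assms by (simp add: a0_def)
  have [measurable]: "wealth X C n \<in> borel_measurable (info X n)"
    by (rule wealth_measurable[OF assms])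
  show ?thesis unfolding growth_def by measurable
qed

lemma weighted_log_growth_measurable:
  assumes "a0 X C"
  shows "(\<lambda>\<omega>. wgt X (st X n \<omega>) l * ln (growth X C n \<omega> l)) \<in> borel_measurable (info X n)"
  using growth_measurable[OF assms, of n l] by measurable

lemma a1_wealth_pos:
  assumes "a1 X C"
  shows "AE \<omega> in prb X. wealth X C n \<omega> > 0"
proof -
  have "AE \<omega> in prb X. (\<forall>s. C n \<omega> $ s \<ge> 0) \<and> comp_sum (C n \<omega>) < wealth X C n \<omega>"
    using assms by (simp add: a1_def)
  then show ?thesis
  proof eventually_elim
    case (elim \<omega>)
    then have "comp_sum (C n \<omega>) \<ge> 0" by (auto simp: comp_sum_def intro: sum_nonneg)
    with elim show ?case by linarith
  qed
qed

lemma a2_growth_bound: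
  assumes "a0 X C" "a2 X C"
  shows "AE \<omega> in prb X. \<forall>l. tr X (st X n \<omega>) l > 0 \<longrightarrow> growth X C n \<omega> l \<ge> lvl X"
proof (rule AE_next)
  show "AE \<omega> in prb X. growth X C n \<omega> (st X (Suc n) \<omega>) \<ge> lvl X"
    using assms(2) by (simp add: a2_def growth_def)
  show "Measurable.pred (info X n) (\<lambda>\<omega>. growth X C n \<omega> l \<ge> lvl X)" for l
    using growth_measurable[OF assms(1), of n l] by measurable
qed

text \<open>
  The two conditions complement each other: one covers the transitions of positive probability, the
  other the transitions of probability zero.
\<close>

lemma a2_null_growth_bound:
  assumes "a0 X C" "a2 X C" "a2_null X C"
  shows "AE \<omega> in prb X. \<forall>l. growth X C n \<omega> l \<ge> lvl X"
proof -
  have "AE \<omega> in prb X. \<forall>l. tr X (st X n \<omega>) l = 0 \<longrightarrow> growth X C n \<omega> l \<ge> lvl X"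
    using assms(3) by (simp add: a2_null_def growth_def)
  with a2_growth_bound[OF assms(1,2), of n] show ?thesis
    by eventually_elim (metis tr_nonneg order_le_less)
qed

lemma integrable_Sn_increment:
  assumes C: "a0 X C" and pos: "\<And>j. AE \<omega> in prb X. wealth X C j \<omega> > 0"
    and int: "integrable (prb X) (Sn X C n)" "integrable (prb X) (Sn X C (Suc n))"
  shows "integrable (prb X) (\<lambda>\<omega>. wgt X (st X n \<omega>) (st X (Suc n) \<omega>) * ln (growth X C n \<omega> (st X (Suc n) \<omega>)))"
proof (rule integrable_cong_AE_imp)
  show "integrable (prb X) (\<lambda>\<omega>. Sn X C (Suc n) \<omega> - Sn X C n \<omega>)" using int by simp
  show "AE \<omega> in prb X. Sn X C (Suc n) \<omega> - Sn X C n \<omega> =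
      wgt X (st X n \<omega>) (st X (Suc n) \<omega>) * ln (growth X C n \<omega> (st X (Suc n) \<omega>))"
    using pos[of n] by eventually_elim (simp add: Sn_Suc)
  show "(\<lambda>\<omega>. wgt X (st X n \<omega>) (st X (Suc n) \<omega>) * ln (growth X C n \<omega> (st X (Suc n) \<omega>))) \<in> borel_measurable (prb X)"
    by (rule measurable_info_prb[OF borel_measurable_next[OF weighted_log_growth_measurable[OF C]]])
qed

lemma Sn_measurable:
  assumes "a0 X C"
  shows "Sn X C n \<in> borel_measurable (info X n)"
proof -
  have "(\<lambda>\<omega>. wgt X (st X (j - 1) \<omega>) (st X j \<omega>) * ln (wealth X C j \<omega> / wealth X C (j - 1) \<omega>))
      \<in> borel_measurable (info X n)" if jn: "j \<in> {1..n}" for j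
  proof -
    obtain i where j: "j = Suc i" using jn by (cases j) auto
    have [measurable]: "wealth X C i \<in> borel_measurable (info X n)" "wealth X C (Suc i) \<in> borel_measurable (info X n)"
      using jn j measurable_info_mono[OF wealth_measurable[OF assms, of i], of n]
       measurable_info_mono[OF wealth_measurable[OF assms, of "Suc i"], of n] by auto
    have "(\<lambda>\<omega>. wgt X (st X i \<omega>) (st X (Suc i) \<omega>)) \<in> borel_measurable (info X (Suc i))"
      by (rule borel_measurable_next) measurable
    then have [measurable]: "(\<lambda>\<omega>. wgt X (st X i \<omega>) (st X (Suc i) \<omega>)) \<in> borel_measurable (info X n)"
      using jn j measurable_info_mono[of _ "Suc i" borel n] by simp
    show ?thesis unfolding j by (simp del: wealth.simps)
  qed
  then have "(\<lambda>\<omega>. \<Sum>j=1..n. wgt X (st X (j - 1) \<omega>) (st X j \<omega>) * ln (wealth X C j \<omega> / wealth X C (j - 1) \<omega>))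
      \<in> borel_measurable (info X n)"
    by (intro borel_measurable_sum)
  then show ?thesis by (simp add: Sn_def[abs_def])
qed

lemma An_measurable: "An X q n \<in> borel_measurable (info X n)"
proof -
  have "(\<lambda>\<omega>. alpha X q (j - 1) (st X (j - 1) \<omega>)) \<in> borel_measurable (info X n)" if "j \<in> {1..n}" for j
  proof -
    have "j - 1 \<le> n" using that by auto
    from measurable_compose[OF st_measurable_info[OF this], of "alpha X q (j - 1)" borel]
    show ?thesis by simp
  qed
  then have "(\<lambda>\<omega>. \<Sum>j=1..n. alpha X q (j - 1) (st X (j - 1) \<omega>)) \<in> borel_measurable (info X n)"
    by (intro borel_measurable_sum)
  then show ?thesis by (simp add: An_def[abs_def])
qed

lemma adapted_Sn_An:
  assumes "calibrating X q" "a0 X C" "\<forall>n. integrable (prb X) (Sn X C n)"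
  shows "adapted_L1 (prb X) (info X) (\<lambda>n \<omega>. Sn X C n \<omega> - An X q n \<omega>)"
  using assms filtration_info subalgebra_info An_measurable Sn_measurable
  by (auto simp: adapted_L1_def calibrating_def)

end

section \<open>The drift of the calibrated log-growth\<close>

text \<open>
  For \<open>p > 0\<close> this is \<open>w * p\<close> times \<open>ln x \<le> x - 1\<close> at \<open>x = r * q / p\<close>.  For \<open>p = 0\<close> the left-hand side
  is \<open>0\<close> and the right-hand side \<open>w * r * q\<close>, so that equality forces \<open>w = 0\<close>; this agrees with the
  stated equality condition since \<open>q > 0\<close>.
\<close>

lemma log_ratio_le:
  fixes w p q r :: real
  assumes "w \<ge> 0" "p \<ge> 0" "q > 0" "r > 0"
  shows "w * p * ln r - w * p * ln (p / q) \<le> w * (r * q - p)"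
    and "w * p * ln r - w * p * ln (p / q) = w * (r * q - p) \<longleftrightarrow> (w > 0 \<longrightarrow> q = p / r)"
proof -
  have *: "(w * p * ln r - w * p * ln (p / q) \<le> w * (r * q - p)) \<and>
     (w * p * ln r - w * p * ln (p / q) = w * (r * q - p) \<longleftrightarrow> (w > 0 \<longrightarrow> q = p / r))"
  proof (cases "w = 0 \<or> p = 0")
    case True
    then show ?thesis using assms by (auto simp: mult_less_0_iff)
  next
    case False
    then have wp: "w > 0" "p > 0" using assms by auto
    define x where "x = r * q / p"
    have x: "x > 0" "r * q = p * x" using wp assms by (auto simp: x_def)
    have l: "w * p * ln r - w * p * ln (p / q) = w * p * ln x"
      using wp assms by (simp add: x_def ln_div ln_mult algebra_simps)
    have r: "w * (r * q - p) = w * p * (x - 1)" unfolding x(2) by (simp add: algebra_simps)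
    have e: "ln x = x - 1 \<longleftrightarrow> q = p / r"
      using ln_eq_minus_one[OF x(1)] wp assms by (auto simp: x_def field_simps)
    show ?thesis unfolding l r using wp e ln_le_minus_one[OF x(1)] by simp
  qed
  show "w * p * ln r - w * p * ln (p / q) \<le> w * (r * q - p)"
    and "w * p * ln r - w * p * ln (p / q) = w * (r * q - p) \<longleftrightarrow> (w > 0 \<longrightarrow> q = p / r)"
    using * by blast+
qed

context market_model
begin

text \<open>
  The two logarithms are not merged into one because \<open>q * growth / p\<close> has no value where \<open>p = 0\<close>;
  kept apart, both terms vanish there.
\<close>

lemma cond_exp_increment:
  assumes q: "calibrating X q" and C: "a0 X C" and pos: "\<And>j. AE \<omega> in prb X. wealth X C j \<omega> > 0"
    and int: "\<forall>n. integrable (prb X) (Sn X C n)"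
  shows "AE \<omega> in prb X.
    ((\<lambda>l. wgt X (st X n \<omega>) l * tr X (st X n \<omega>) l * ln (growth X C n \<omega> l)
        - wgt X (st X n \<omega>) l * tr X (st X n \<omega>) l * ln (tr X (st X n \<omega>) l / q (Suc n) (st X n \<omega>) l))
      has_sum real_cond_exp (prb X) (info X n)
      (\<lambda>\<omega>. (Sn X C (Suc n) \<omega> - An X q (Suc n) \<omega>) - (Sn X C n \<omega> - An X q n \<omega>)) \<omega>) UNIV"
proof -
  interpret F: sigma_finite_subalgebra "prb X" "info X n" by (rule cond_exp_info)
  let ?U = "\<lambda>\<omega> l. wgt X (st X n \<omega>) l * ln (growth X C n \<omega> l)"
  let ?S = "\<lambda>\<omega>. ?U \<omega> (st X (Suc n) \<omega>)" and ?A = "\<lambda>\<omega>. alpha X q n (st X n \<omega>)"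
  let ?Y = "\<lambda>\<omega>. (Sn X C (Suc n) \<omega> - An X q (Suc n) \<omega>) - (Sn X C n \<omega> - An X q n \<omega>)"
  have intS: "integrable (prb X) ?S"
    by (rule integrable_Sn_increment[OF C pos]) (use int in auto)
  have intA: "integrable (prb X) ?A"
  proof -
    have "integrable (prb X) (\<lambda>\<omega>. An X q (Suc n) \<omega> - An X q n \<omega>)"
      using q by (intro Bochner_Integration.integrable_diff) (auto simp: calibrating_def)
    then show ?thesis by (simp add: An_Suc)
  qed
  have "AE \<omega> in prb X. real_cond_exp (prb X) (info X n) ?Y \<omega>
      = real_cond_exp (prb X) (info X n) (\<lambda>\<omega>. ?S \<omega> - ?A \<omega>) \<omega>"
  proof (rule F.real_cond_exp_cong)
    show "AE \<omega> in prb X. ?Y \<omega> = ?S \<omega> - ?A \<omega>"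
      using pos[of n] by eventually_elim (simp add: Sn_Suc An_Suc)
    show "?Y \<in> borel_measurable (prb X)"
      using q int by (auto simp: calibrating_def intro!: borel_measurable_diff borel_measurable_integrable)
    show "(\<lambda>\<omega>. ?S \<omega> - ?A \<omega>) \<in> borel_measurable (prb X)"
      using intS intA by (intro borel_measurable_diff borel_measurable_integrable)
  qed
  moreover have "AE \<omega> in prb X. real_cond_exp (prb X) (info X n) (\<lambda>\<omega>. ?S \<omega> - ?A \<omega>) \<omega>
      = real_cond_exp (prb X) (info X n) ?S \<omega> - real_cond_exp (prb X) (info X n) ?A \<omega>"
    by (rule F.real_cond_exp_diff[OF intS intA])
  moreover have "AE \<omega> in prb X. real_cond_exp (prb X) (info X n) ?A \<omega> = ?A \<omega>"
    by (rule F.real_cond_exp_F_meas[OF intA]) measurable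
  moreover have "AE \<omega> in prb X. ((\<lambda>l. tr X (st X n \<omega>) l * ?U \<omega> l) has_sum
     real_cond_exp (prb X) (info X n) ?S \<omega>) UNIV"
    by (rule cond_exp_next[OF weighted_log_growth_measurable[OF C] intS])
  ultimately show ?thesis
  proof eventually_elim
    case (elim \<omega>)
    let ?f = "\<lambda>l. wgt X (st X n \<omega>) l * tr X (st X n \<omega>) l * ln (growth X C n \<omega> l)"
    let ?g = "\<lambda>l. wgt X (st X n \<omega>) l * tr X (st X n \<omega>) l * ln (tr X (st X n \<omega>) l / q (Suc n) (st X n \<omega>) l)"
    have f: "(\<lambda>l. tr X (st X n \<omega>) l * ?U \<omega> l) = ?f" by (simp add: mult_ac)
    have g: "(?g has_sum alpha X q n (st X n \<omega>)) UNIV"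
      using q by (simp add: calibrating_def alpha_def)
    show ?case
      using elim has_sum_diff[OF _ g, of ?f] unfolding f by simp
  qed
qed

text \<open>
  The majorant of the drift given by \<open>log_ratio_le\<close> is \<open>\<Sum>l. \<phi> (growth * q - p)\<close>, which equals the
  sum in (q-p) because \<open>a3\<close> annihilates the part of the growth factor that comes from the risky
  assets.
\<close>

lemma drift_nonpos:
  assumes q: "calibrating X q" and C: "a0 X C" "a1 X C" "a2 X C" "a2_null X C" "a3 X q C"
    and int: "\<forall>n. integrable (prb X) (Sn X C n)"
  shows "AE \<omega> in prb X.
    real_cond_exp (prb X) (info X n)
      (\<lambda>\<omega>. (Sn X C (Suc n) \<omega> - An X q (Suc n) \<omega>) - (Sn X C n \<omega> - An X q n \<omega>)) \<omega> \<le> 0 \<and>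
    (real_cond_exp (prb X) (info X n)
      (\<lambda>\<omega>. (Sn X C (Suc n) \<omega> - An X q (Suc n) \<omega>) - (Sn X C n \<omega> - An X q n \<omega>)) \<omega> = 0 \<longleftrightarrow>
     (\<forall>k. wgt X (st X n \<omega>) k > 0 \<longrightarrow>
        q (Suc n) (st X n \<omega>) k = tr X (st X n \<omega>) k / growth X C n \<omega> k))"
proof -
  have pos: "AE \<omega> in prb X. wealth X C j \<omega> > 0" for j by (rule a1_wealth_pos[OF C(2)])
  have a3: "AE \<omega> in prb X.
     ((\<lambda>l. wgt X (st X n \<omega>) l * q (Suc n) (st X n \<omega>) l * (C n \<omega> \<bullet> exret X (st X n \<omega>) l))
        has_sum 0) UNIV"
    using C(5) by (simp add: a3_def)
  show ?thesis
    using cond_exp_increment[OF q C(1) pos int, of n] pos[of n] a3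
      a2_null_growth_bound[OF C(1,3,4), of n]
  proof eventually_elim
    case (elim \<omega>)
    let ?i = "st X n \<omega>" and ?Z = "wealth X C n \<omega>"
    let ?f = "\<lambda>l. wgt X ?i l * tr X ?i l * ln (growth X C n \<omega> l)
        - wgt X ?i l * tr X ?i l * ln (tr X ?i l / q (Suc n) ?i l)"
    let ?h = "\<lambda>l. wgt X ?i l * (growth X C n \<omega> l * q (Suc n) ?i l - tr X ?i l)"
    let ?c = "\<lambda>l. wgt X ?i l * ((1 + rate X) * q (Suc n) ?i l - tr X ?i l)"
    let ?d = "real_cond_exp (prb X) (info X n)
      (\<lambda>\<omega>. (Sn X C (Suc n) \<omega> - An X q (Suc n) \<omega>) - (Sn X C n \<omega> - An X q n \<omega>)) \<omega>"
    have qpos: "q (Suc n) ?i l > 0" for l using q by (simp add: calibrating_def)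
    have gpos: "growth X C n \<omega> l > 0" for l using elim(4) lvl_pos less_le_trans by blast
    have c: "(?c has_sum infsum ?c UNIV) UNIV" "infsum ?c UNIV \<le> 0"
      using q by (simp_all add: calibrating_def)
    \<comment> \<open>The growth factor splits into the riskless return, which goes with (q-p), and the excess return
      of the risky assets, which goes with \<open>a3\<close>.\<close>
    have "((\<lambda>l. ?c l + 1 / ?Z * (wgt X ?i l * q (Suc n) ?i l * (C n \<omega> \<bullet> exret X ?i l)))
        has_sum (infsum ?c UNIV + 1 / ?Z * 0)) UNIV"
      by (rule has_sum_add[OF c(1) has_sum_cmult_right[OF elim(3)]])
    also have "(\<lambda>l. ?c l + 1 / ?Z * (wgt X ?i l * q (Suc n) ?i l * (C n \<omega> \<bullet> exret X ?i l))) = ?h"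
      using elim(2) by (simp add: growth_def field_simps)
    finally have h: "(?h has_sum infsum ?c UNIV) UNIV" by simp
    have fh: "?f l \<le> ?h l" and fh_eq: "?f l = ?h l \<longleftrightarrow> (wgt X ?i l > 0 \<longrightarrow> q (Suc n) ?i l = tr X ?i l / growth X C n \<omega> l)" for l
      using log_ratio_le[OF wgt_nonneg tr_nonneg qpos gpos] by blast+
    have "?d \<le> 0" by (rule has_sum_nonpos_by_majorant(1)[OF elim(1) h c(2) fh])
    moreover have "?f l = ?h l" if "?d = 0" for l
      by (rule has_sum_nonpos_by_majorant(2)[OF elim(1) h c(2) fh that UNIV_I])
    moreover have "?d = 0" if *: "\<forall>k. wgt X ?i k > 0 \<longrightarrow> q (Suc n) ?i k = tr X ?i k / growth X C n \<omega> k"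
    proof -
      have "?f l = 0" for l
      proof (cases "wgt X ?i l = 0 \<or> tr X ?i l = 0")
        case False
        then have "growth X C n \<omega> l = tr X ?i l / q (Suc n) ?i l"
          using * wgt_nonneg[of ?i l] gpos[of l] by (auto simp: order_le_less)
        then show ?thesis by simp
      qed auto
      then have "(?f has_sum 0) UNIV" by (intro has_sum_0) auto
      from has_sum_unique[OF elim(1) this] show ?thesis .
    qed
    ultimately show ?case unfolding fh_eq by blast
  qed
qed

lemma supermartingale_Sn_An:
  assumes "calibrating X q" "a0 X C" "a1 X C" "a2 X C" "a2_null X C" "a3 X q C"
    and "\<forall>n. integrable (prb X) (Sn X C n)"
  shows "supermartingale (prb X) (info X) (\<lambda>n \<omega>. Sn X C n \<omega> - An X q n \<omega>)"
proof (rule supermartingale_if_increments[OF cond_exp_info adapted_Sn_An])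
  fix n
  show "AE \<omega> in prb X. real_cond_exp (prb X) (info X n)
      (\<lambda>\<omega>. (Sn X C (Suc n) \<omega> - An X q (Suc n) \<omega>) - (Sn X C n \<omega> - An X q n \<omega>)) \<omega> \<le> 0"
    using drift_nonpos[OF assms, of n] by eventually_elim blast
qed (use assms in auto)

lemma martingale_Sn_An_iff:
  assumes "calibrating X q" "a0 X C" "a1 X C" "a2 X C" "a2_null X C" "a3 X q C"
    and "\<forall>n. integrable (prb X) (Sn X C n)"
  shows "martingale (prb X) (info X) (\<lambda>n \<omega>. Sn X C n \<omega> - An X q n \<omega>) \<longleftrightarrow>
    (\<forall>j. AE \<omega> in prb X. \<forall>k. wgt X (st X j \<omega>) k > 0 \<longrightarrow>
       q (Suc j) (st X j \<omega>) k = tr X (st X j \<omega>) k / growth X C j \<omega> k)"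
proof -
  have "(AE \<omega> in prb X. real_cond_exp (prb X) (info X n)
      (\<lambda>\<omega>. (Sn X C (Suc n) \<omega> - An X q (Suc n) \<omega>) - (Sn X C n \<omega> - An X q n \<omega>)) \<omega> = 0) \<longleftrightarrow>
    (AE \<omega> in prb X. \<forall>k. wgt X (st X n \<omega>) k > 0 \<longrightarrow>
       q (Suc n) (st X n \<omega>) k = tr X (st X n \<omega>) k / growth X C n \<omega> k)" for n
  proof (rule eventually_subst)
    show "AE \<omega> in prb X. (real_cond_exp (prb X) (info X n)
      (\<lambda>\<omega>. (Sn X C (Suc n) \<omega> - An X q (Suc n) \<omega>) - (Sn X C n \<omega> - An X q n \<omega>)) \<omega> = 0) =
      (\<forall>k. wgt X (st X n \<omega>) k > 0 \<longrightarrow>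
       q (Suc n) (st X n \<omega>) k = tr X (st X n \<omega>) k / growth X C n \<omega> k)"
      using drift_nonpos[OF assms, of n] by eventually_elim blast
  qed
  then show ?thesis
    using martingale_iff_increments[OF cond_exp_info adapted_Sn_An] assms by simp
qed

text \<open>
  Both \<open>S\<close> and \<open>A\<close> start at \<open>0\<close>.
\<close>

lemma martingale_expectation:
  assumes "martingale (prb X) (info X) (\<lambda>n \<omega>. Sn X C n \<omega> - An X q n \<omega>)"
    and q: "calibrating X q" and int: "\<forall>n. integrable (prb X) (Sn X C n)"
  shows "integral\<^sup>L (prb X) (Sn X C n)
    = (\<Sum>j=1..n. integral\<^sup>L (prb X) (\<lambda>\<omega>. alpha X q (j - 1) (st X (j - 1) \<omega>)))"
proof -
  interpret F: sigma_finite_subalgebra "prb X" "info X 0" by (rule cond_exp_info)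
  let ?Y = "\<lambda>\<omega>. Sn X C n \<omega> - An X q n \<omega>"
  have iA: "integrable (prb X) (An X q n)" for n using q by (simp add: calibrating_def)
  have iY: "integrable (prb X) ?Y" using int iA by simp
  have "AE \<omega> in prb X. real_cond_exp (prb X) (info X 0) ?Y \<omega> = Sn X C 0 \<omega> - An X q 0 \<omega>"
    using assms(1) unfolding martingale_def by simp
  then have "AE \<omega> in prb X. real_cond_exp (prb X) (info X 0) ?Y \<omega> = 0" by (simp add: Sn_def An_def)
  then have "(\<integral>\<omega>. ?Y \<omega> \<partial>prb X) = 0"
    using F.real_cond_exp_int(2)[OF iY] integral_eq_zero_AE by metis
  then have "integral\<^sup>L (prb X) (Sn X C n) = integral\<^sup>L (prb X) (An X q n)" using int iA by simp
  also have "integrable (prb X) (\<lambda>\<omega>. alpha X q j (st X j \<omega>))" for j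
    using Bochner_Integration.integrable_diff[OF iA[of "Suc j"] iA[of j]] by (simp add: An_Suc)
  then have "integral\<^sup>L (prb X) (An X q n)
      = (\<Sum>j=1..n. integral\<^sup>L (prb X) (\<lambda>\<omega>. alpha X q (j - 1) (st X (j - 1) \<omega>)))"
    unfolding An_def[abs_def] by (intro Bochner_Integration.integral_sum) 
  finally show ?thesis .
qed

lemma supermartingale_expectation:
  assumes "supermartingale (prb X) (info X) (\<lambda>n \<omega>. Sn X C n \<omega> - An X q n \<omega>)"
    and q: "calibrating X q" and int: "\<forall>n. integrable (prb X) (Sn X C n)"
  shows "integral\<^sup>L (prb X) (Sn X C n) \<le> integral\<^sup>L (prb X) (An X q n)"
proof -
  interpret F: sigma_finite_subalgebra "prb X" "info X 0" by (rule cond_exp_info)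
  let ?Y = "\<lambda>\<omega>. Sn X C n \<omega> - An X q n \<omega>"
  have iA: "integrable (prb X) (An X q n)" using q by (simp add: calibrating_def)
  have iY: "integrable (prb X) ?Y" using int iA by simp
  have "AE \<omega> in prb X. real_cond_exp (prb X) (info X 0) ?Y \<omega> \<le> Sn X C 0 \<omega> - An X q 0 \<omega>"
    using assms(1) unfolding supermartingale_def by simp
  then have "AE \<omega> in prb X. real_cond_exp (prb X) (info X 0) ?Y \<omega> \<le> 0" by (simp add: Sn_def An_def)
  then have "(\<integral>\<omega>. real_cond_exp (prb X) (info X 0) ?Y \<omega> \<partial>prb X) \<le> (\<integral>\<omega>. 0 \<partial>prb X)"
    using F.real_cond_exp_int(1)[OF iY] by (intro integral_mono_AE) auto
  then show ?thesis using F.real_cond_exp_int(2)[OF iY] int iA by simp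
qed

section \<open>Proportional portfolios\<close>

abbreviation prop_growth :: "('m \<Rightarrow> real ^ 'k) \<Rightarrow> 'm \<Rightarrow> 'm \<Rightarrow> real" where
  "prop_growth D i l \<equiv> 1 + rate X + D i \<bullet> exret X i l"

lemma prop_growth_pos: "i2 X D \<Longrightarrow> prop_growth D i l > 0"
  using lvl_pos by (auto simp: i2_def intro: less_le_trans)

lemma proportional_growth:
  assumes "\<forall>s. C n \<omega> $ s = D (st X n \<omega>) $ s * wealth X C n \<omega>" "wealth X C n \<omega> > 0"
  shows "C n \<omega> = wealth X C n \<omega> *\<^sub>R D (st X n \<omega>)"
    and "growth X C n \<omega> l = prop_growth D (st X n \<omega>) l"
proof -
  show C: "C n \<omega> = wealth X C n \<omega> *\<^sub>R D (st X n \<omega>)"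
    using assms(1) by (simp add: vec_eq_iff mult.commute)
  show "growth X C n \<omega> l = prop_growth D (st X n \<omega>) l"
    using assms(2) unfolding growth_def by (subst C) simp
qed

lemma proportional_wealth_pos:
  assumes D: "i2 X D" "proportional X D C"
  shows "AE \<omega> in prb X. wealth X C n \<omega> > 0"
proof (induction n)
  case 0
  show ?case using cap0_pos by simp
next
  case (Suc n)
  have "AE \<omega> in prb X. \<forall>s. C n \<omega> $ s = D (st X n \<omega>) $ s * wealth X C n \<omega>"
    using D(2) by (simp add: proportional_def)
  with Suc show ?case
  proof eventually_elim
    case (elim \<omega>)
    then show ?case
      using wealth_Suc_growth[of X C n \<omega>] proportional_growth(2)[of C n \<omega> D, OF elim(2,1)] prop_growth_pos[OF D(1)]
      by simp
  qed
qed

text \<open>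
  A proportional portfolio makes the growth factor a function of the current and the next state; this
  is what reduces conditions on strategies to conditions on \<open>D\<close>.
\<close>

lemma AE_proportional:
  assumes D: "i2 X D" "proportional X D C"
  shows "AE \<omega> in prb X. wealth X C n \<omega> > 0 \<and> C n \<omega> = wealth X C n \<omega> *\<^sub>R D (st X n \<omega>) \<and>
    (\<forall>l. growth X C n \<omega> l = prop_growth D (st X n \<omega>) l)"
proof -
  have "AE \<omega> in prb X. \<forall>s. C n \<omega> $ s = D (st X n \<omega>) $ s * wealth X C n \<omega>"
    using D(2) by (simp add: proportional_def)
  with proportional_wealth_pos[OF D, of n] show ?thesis
    by eventually_elim (blast intro: proportional_growth)
qed

lemma proportional_admissible:
  assumes D: "i1 X D" "i2 X D" "proportional X D C"
  shows "a1 X C" "a2 X C" "a2_null X C"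
proof -
  have bound: "AE \<omega> in prb X. \<forall>l. growth X C n \<omega> l \<ge> lvl X" for n
    using AE_proportional[OF D(2,3), of n] by eventually_elim (use D(2) in \<open>auto simp: i2_def\<close>)
  show "a2 X C" unfolding a2_def
  proof
    fix j show "AE \<omega> in prb X. 1 + rate X + (C j \<omega> \<bullet> exret X (st X j \<omega>) (st X (Suc j) \<omega>)) / wealth X C j \<omega> \<ge> lvl X"
      using bound[of j] by eventually_elim (simp add: growth_def)
  qed
  show "a2_null X C" unfolding a2_null_def
  proof
    fix j show "AE \<omega> in prb X. \<forall>l. tr X (st X j \<omega>) l = 0 \<longrightarrow>
      1 + rate X + (C j \<omega> \<bullet> exret X (st X j \<omega>) l) / wealth X C j \<omega> \<ge> lvl X"
      using bound[of j] by eventually_elim (simp add: growth_def)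
  qed
  show "a1 X C" unfolding a1_def
  proof
    fix j show "AE \<omega> in prb X. (\<forall>s. C j \<omega> $ s \<ge> 0) \<and> comp_sum (C j \<omega>) < wealth X C j \<omega>"
      using AE_proportional[OF D(2,3), of j]
    proof eventually_elim
      case (elim \<omega>)
      have "comp_sum (wealth X C j \<omega> *\<^sub>R D (st X j \<omega>)) = wealth X C j \<omega> * comp_sum (D (st X j \<omega>))"
        by (simp add: comp_sum_def sum_distrib_left)
      moreover have "comp_sum (D (st X j \<omega>)) < 1" "\<forall>s. D (st X j \<omega>) $ s \<ge> 0"
        using D(1) by (simp_all add: i1_def)
      moreover have "C j \<omega> $ s = wealth X C j \<omega> * D (st X j \<omega>) $ s" for s
        using arg_cong[OF elim[THEN conjunct2, THEN conjunct1], of "\<lambda>v. v $ s"] by simp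
      ultimately show ?case using elim by simp
    qed
  qed
qed

lemma proportional_a3:
  assumes D: "i2 X D" "i3 X D" "i4 X D q" "proportional X D C"
  shows "a3 X q C"
  unfolding a3_def
proof
  fix j
  show "AE \<omega> in prb X. ((\<lambda>l. wgt X (st X j \<omega>) l * q (Suc j) (st X j \<omega>) l * (C j \<omega> \<bullet> exret X (st X j \<omega>) l))
        has_sum 0) UNIV"
    using AE_proportional[OF D(1,4), of j]
  proof eventually_elim
    case (elim \<omega>)
    let ?i = "st X j \<omega>"
    have eq: "wgt X ?i l * q (Suc j) ?i l * (C j \<omega> \<bullet> exret X ?i l)
      = wealth X C j \<omega> * (wgt X ?i l * tr X ?i l * ((D ?i \<bullet> exret X ?i l) / prop_growth D ?i l))" for l
    proof (cases "wgt X ?i l = 0")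
      case False
      then have "q (Suc j) ?i l = tr X ?i l / prop_growth D ?i l"
        using D(3) wgt_nonneg[of ?i l] by (simp add: i4_def)
      moreover have "C j \<omega> \<bullet> exret X ?i l = wealth X C j \<omega> * (D ?i \<bullet> exret X ?i l)"
        using elim by (metis inner_scaleR_left)
      ultimately show ?thesis by simp
    qed simp
    have "((\<lambda>l. wgt X ?i l * tr X ?i l * ((D ?i \<bullet> exret X ?i l) / prop_growth D ?i l)) has_sum 0) UNIV"
      using D(2) by (simp add: i3_def)
    from has_sum_cmult_right[OF this, of "wealth X C j \<omega>"] show ?case unfolding eq by simp
  qed
qed

text \<open>
  Strategy and capital determine each other.  The circle is broken by defining the capital \<open>W\<close> first,
  through its growth factors, and the strategy from it.
\<close>

lemma exists_proportional: "\<exists>C. proportional X D C \<and> a0 X C"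
proof -
  define W where "W = rec_nat (cap0 X) (\<lambda>n w \<omega>. w \<omega> * prop_growth D (st X n \<omega>) (st X (Suc n) \<omega>))"
  have W_Suc: "W (Suc n) \<omega> = W n \<omega> * prop_growth D (st X n \<omega>) (st X (Suc n) \<omega>)" for n \<omega>
    by (simp add: W_def)
  define C where "C = (\<lambda>n \<omega>. W n \<omega> *\<^sub>R D (st X n \<omega>))"
  have cs: "comp_sum (c *\<^sub>R v) = c * comp_sum v" for c and v :: "real ^ 'k"
    by (simp add: comp_sum_def sum_distrib_left)
  have wealth: "wealth X C n \<omega> = W n \<omega>" for n \<omega>
  proof (induction n)
    case 0 show ?case by (simp add: W_def)
  next
    case (Suc n) then show ?case
      by (simp add: W_Suc C_def cs inner_ret algebra_simps)
  qed
  have W_meas: "W n \<in> borel_measurable (info X n)" for n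
  proof (induction n)
    case 0
    show ?case by (simp add: W_def cap0_measurable_info)
  next
    case (Suc n)
    have [measurable]: "W n \<in> borel_measurable (info X (Suc n))"
      using Suc measurable_info_mono[of _ n borel "Suc n"] by simp
    have [measurable]: "(\<lambda>\<omega>. prop_growth D (st X n \<omega>) (st X (Suc n) \<omega>)) \<in> borel_measurable (info X (Suc n))"
      by (rule borel_measurable_next) measurable
    have "W (Suc n) = (\<lambda>\<omega>. W n \<omega> * prop_growth D (st X n \<omega>) (st X (Suc n) \<omega>))"
      by (rule ext) (rule W_Suc)
    then show ?case by simp
  qed
  have "a0 X C"
    unfolding a0_def
  proof
    fix n
    have [measurable]: "W n \<in> borel_measurable (info X n)" by (rule W_meas)
    show "C n \<in> borel_measurable (info X n)" unfolding C_def by measurable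
  qed
  moreover have "proportional X D C"
    unfolding proportional_def wealth by (simp add: C_def mult.commute)
  ultimately show ?thesis by blast
qed

lemma log_growth_measurable: "log_growth X D n \<in> borel_measurable (prb X)"
proof -
  have "(\<lambda>\<omega>. wgt X (st X n \<omega>) (st X (Suc n) \<omega>) * ln (prop_growth D (st X n \<omega>) (st X (Suc n) \<omega>)))
      \<in> borel_measurable (info X (Suc n))"
    by (rule borel_measurable_next) measurable
  then show ?thesis by (simp add: log_growth_def[abs_def] measurable_info_prb)
qed

lemma AE_Sn_sum:
  assumes "\<And>j. AE \<omega> in prb X. wealth X C j \<omega> > 0"
  shows "AE \<omega> in prb X. Sn X C n \<omega>
    = (\<Sum>j<n. wgt X (st X j \<omega>) (st X (Suc j) \<omega>) * ln (growth X C j \<omega> (st X (Suc j) \<omega>)))"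
proof (induction n)
  case 0
  show ?case by (simp add: Sn_def)
next
  case (Suc n)
  with assms[of n] show ?case by eventually_elim (simp add: Sn_Suc)
qed

lemma Sn_proportional:
  assumes D: "i2 X D" "proportional X D C" and C: "a0 X C" and conv: "En_converges X n D"
  shows "\<forall>m\<le>n. integrable (prb X) (Sn X C m)" "integral\<^sup>L (prb X) (Sn X C n) = En X n D"
proof -
  have AE: "AE \<omega> in prb X. (\<Sum>j<m. log_growth X D j \<omega>) = Sn X C m \<omega>" for m
  proof -
    have "AE \<omega> in prb X. \<forall>j. \<forall>l. growth X C j \<omega> l = prop_growth D (st X j \<omega>) l"
      using AE_proportional[OF D] by (auto simp: AE_all_countable)
    with AE_Sn_sum[OF proportional_wealth_pos[OF D], of m] show ?thesis
      by eventually_elim (simp add: log_growth_def)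
  qed
  have meas: "Sn X C m \<in> borel_measurable (prb X)" for m
    by (rule measurable_info_prb[OF Sn_measurable[OF C]])
  have int: "integrable (prb X) (log_growth X D j)" if "j < n" for j
    using conv that by (simp add: En_converges_def)
  show "\<forall>m\<le>n. integrable (prb X) (Sn X C m)"
    using int by (auto intro!: integrable_cong_AE_imp[OF _ meas AE])
  have "integral\<^sup>L (prb X) (Sn X C n) = (\<integral>\<omega>. (\<Sum>j<n. log_growth X D j \<omega>) \<partial>prb X)"
    using AE[of n] log_growth_measurable by (intro integral_cong_AE meas) (auto elim: eventually_mono)
  also have "\<dots> = (\<Sum>j<n. beta X D j)"
    unfolding beta_def using int by (intro Bochner_Integration.integral_sum) auto
  also have "\<dots> = En X n D" by (simp add: En_def sum.atLeast1_atMost_eq)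
  finally show "integral\<^sup>L (prb X) (Sn X C n) = En X n D" .
qed

lemma proportional_martingale:
  assumes q: "calibrating X q" and C: "a0 X C" and int: "\<forall>n. integrable (prb X) (Sn X C n)"
    and D: "i1 X D" "i2 X D" "i3 X D" "i4 X D q" "proportional X D C"
  shows "martingale (prb X) (info X) (\<lambda>n \<omega>. Sn X C n \<omega> - An X q n \<omega>)"
proof -
  note adm = proportional_admissible[OF D(1,2,5)] proportional_a3[OF D(2-5)]
  have "AE \<omega> in prb X. \<forall>k. wgt X (st X j \<omega>) k > 0 \<longrightarrow>
       q (Suc j) (st X j \<omega>) k = tr X (st X j \<omega>) k / growth X C j \<omega> k" for j
    using AE_proportional[OF D(2,5), of j] by eventually_elim (use D(4) in \<open>simp add: i4_def\<close>)
  then show ?thesis using martingale_Sn_An_iff[OF q C adm int] by blast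
qed

lemma proportional_optimal_portfolio:
  assumes D: "i1 X D" "i2 X D" "En_converges X n D"
  obtains C where "proportional X D C" "a0 X C" "a1 X C" "a2 X C" "a2_null X C"
    "\<forall>m\<le>n. integrable (prb X) (Sn X C m)" "integral\<^sup>L (prb X) (Sn X C n) = En X n D"
proof -
  obtain C where C: "proportional X D C" "a0 X C" using exists_proportional by blast
  with proportional_admissible[OF D(1,2) C(1)] Sn_proportional[OF D(2) C D(3)] that
  show ?thesis by blast
qed

section \<open>Fractions recovered from a martingale\<close>

text \<open>
  A property that holds almost surely at every time can be read off, for each visited state, at a
  single sample point.
\<close>

lemma visited_witness:
  assumes vis: "all_states_visited X" and P: "\<And>j. AE \<omega> in prb X. P j \<omega>"
  obtains j \<omega> where "st X j \<omega> = i" "P j \<omega>"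
proof (rule ccontr)
  assume no: "\<not> thesis"
  obtain j where j: "measure (prb X) {\<omega> \<in> space (prb X). st X j \<omega> = i} > 0"
    using vis by (auto simp: all_states_visited_def)
  have "AE \<omega> in prb X. st X j \<omega> \<noteq> i" using P[of j] by eventually_elim (use no that in blast)
  then have "measure (prb X) {\<omega> \<in> space (prb X). st X j \<omega> = i} = 0"
    by (simp add: prob_eq_0)
  with j show False by simp
qed

text \<open>
  At a sample point with current state \<open>i\<close> at which all conditions hold, the invested fractions
  \<open>C / Z\<close> satisfy everything that is required of \<open>D(i)\<close>.  The point may belong to any time because the
  calibrating functions are the same at all times.
\<close>

lemma martingale_fractions:
  assumes vis: "all_states_visited X" and q: "calibrating X q" "\<forall>j. q j = q 0"
    and C: "a0 X C" "a1 X C" "a2 X C" "a2_null X C" "a3 X q C"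
    and int: "\<forall>n. integrable (prb X) (Sn X C n)"
    and mart: "martingale (prb X) (info X) (\<lambda>n \<omega>. Sn X C n \<omega> - An X q n \<omega>)"
  shows "\<exists>D. i1 X D \<and> i2 X D \<and> i3 X D \<and> i4 X D q"
proof -
  let ?crit = "\<lambda>j \<omega>. \<forall>k. wgt X (st X j \<omega>) k > 0 \<longrightarrow> q 0 (st X j \<omega>) k = tr X (st X j \<omega>) k / growth X C j \<omega> k"
  let ?P = "\<lambda>j \<omega>. wealth X C j \<omega> > 0 \<and> (\<forall>s. C j \<omega> $ s \<ge> 0) \<and> comp_sum (C j \<omega>) < wealth X C j \<omega>
      \<and> (\<forall>l. growth X C j \<omega> l \<ge> lvl X) \<and> ?crit j \<omega> \<and>
      ((\<lambda>l. wgt X (st X j \<omega>) l * q 0 (st X j \<omega>) l * (C j \<omega> \<bullet> exret X (st X j \<omega>) l)) has_sum 0) UNIV"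
  have AE_P: "AE \<omega> in prb X. ?P j \<omega>" for j
  proof -
    have q0: "q (Suc j) = q 0" using q(2) by blast
    have "AE \<omega> in prb X. (\<forall>s. C j \<omega> $ s \<ge> 0) \<and> comp_sum (C j \<omega>) < wealth X C j \<omega>"
      using C(2) by (simp add: a1_def)
    moreover have "AE \<omega> in prb X. \<forall>k. wgt X (st X j \<omega>) k > 0 \<longrightarrow>
        q (Suc j) (st X j \<omega>) k = tr X (st X j \<omega>) k / growth X C j \<omega> k"
      using martingale_Sn_An_iff[OF q(1) C int] mart by blast
    then have "AE \<omega> in prb X. ?crit j \<omega>" unfolding q0 .
    moreover have "AE \<omega> in prb X. ((\<lambda>l. wgt X (st X j \<omega>) l * q 0 (st X j \<omega>) l * (C j \<omega> \<bullet> exret X (st X j \<omega>) l)) has_sum 0) UNIV"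
      using spec[OF C(5)[unfolded a3_def], of j] unfolding q0 .
    ultimately show ?thesis
      using a1_wealth_pos[OF C(2), of j] a2_null_growth_bound[OF C(1,3,4), of j]
      by eventually_elim blast
  qed
  define ok where "ok i d \<longleftrightarrow> (\<forall>s. d $ s \<ge> 0) \<and> comp_sum d < 1 \<and>
      (\<forall>l. 1 + rate X + d \<bullet> exret X i l \<ge> lvl X) \<and>
      (\<forall>k. wgt X i k > 0 \<longrightarrow> q 0 i k = tr X i k / (1 + rate X + d \<bullet> exret X i k)) \<and>
      ((\<lambda>l. wgt X i l * tr X i l * ((d \<bullet> exret X i l) / (1 + rate X + d \<bullet> exret X i l))) has_sum 0) UNIV"
    for i d
  have "\<exists>d. ok i d" for i
  proof -
    obtain j \<omega> where i: "st X j \<omega> = i" and P: "?P j \<omega>" by (rule visited_witness[where P="?P", OF vis AE_P])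
    define Z where "Z = wealth X C j \<omega>"
    define d where "d = (1 / Z) *\<^sub>R C j \<omega>"
    have Z: "Z > 0" and C0: "\<forall>s. C j \<omega> $ s \<ge> 0" and C1: "comp_sum (C j \<omega>) < Z"
      and g: "\<forall>l. growth X C j \<omega> l \<ge> lvl X"
      and crit: "\<forall>k. wgt X i k > 0 \<longrightarrow> q 0 i k = tr X i k / growth X C j \<omega> k"
      and a3: "((\<lambda>l. wgt X i l * q 0 i l * (C j \<omega> \<bullet> exret X i l)) has_sum 0) UNIV"
      using P unfolding i Z_def by blast+
    have gd: "growth X C j \<omega> l = 1 + rate X + d \<bullet> exret X i l" for l
      by (simp add: growth_def d_def i Z_def)
    have "comp_sum d = comp_sum (C j \<omega>) / Z" by (simp add: comp_sum_def d_def sum_divide_distrib)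
    then have 1: "comp_sum d < 1" using C1 Z by simp
    have "(\<lambda>l. 1 / Z * (wgt X i l * q 0 i l * (C j \<omega> \<bullet> exret X i l)))
        = (\<lambda>l. wgt X i l * tr X i l * ((d \<bullet> exret X i l) / (1 + rate X + d \<bullet> exret X i l)))"
    proof
      fix l show "1 / Z * (wgt X i l * q 0 i l * (C j \<omega> \<bullet> exret X i l))
        = wgt X i l * tr X i l * ((d \<bullet> exret X i l) / (1 + rate X + d \<bullet> exret X i l))"
      proof (cases "wgt X i l = 0")
        case False
        then have "q 0 i l = tr X i l / (1 + rate X + d \<bullet> exret X i l)"
          using crit wgt_nonneg[of i l] by (simp add: gd)
        then show ?thesis by (simp add: d_def)
      qed simp
    qed
    with has_sum_cmult_right[OF a3, of "1 / Z"]
    have "((\<lambda>l. wgt X i l * tr X i l * ((d \<bullet> exret X i l) / (1 + rate X + d \<bullet> exret X i l))) has_sum 0) UNIV"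
      by simp
    moreover have "\<forall>s. d $ s \<ge> 0" using C0 Z by (simp add: d_def)
    ultimately show ?thesis using 1 g crit unfolding gd ok_def by blast
  qed
  then obtain D where D: "\<And>i. ok i (D i)" by metis
  have "i4 X D q"
    unfolding i4_def
  proof (intro allI impI)
    fix j i k assume "wgt X i k > 0"
    moreover have "q j = q 0" using q(2) by blast
    ultimately show "q j i k = tr X i k / prop_growth D i k" using D[of i] unfolding ok_def by metis
  qed
  moreover have "i1 X D" "i2 X D" "i3 X D"
    using D unfolding ok_def i1_def i2_def i3_def by blast+
  ultimately show ?thesis by blast
qed

text \<open>
  The criterion determines the growth factors on the transitions of positive weight and probability,
  and without redundancy these determine the fractions.
\<close>

lemma martingale_imp_proportional:
  assumes non: "nonredundant X" and q: "calibrating X q"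
    and D: "i2 X D" "i4 X D q"
    and C: "a0 X C" "a1 X C" "a2 X C" "a2_null X C" "a3 X q C"
    and int: "\<forall>n. integrable (prb X) (Sn X C n)"
    and mart: "martingale (prb X) (info X) (\<lambda>n \<omega>. Sn X C n \<omega> - An X q n \<omega>)"
  shows "proportional X D C"
  unfolding proportional_def
proof
  fix j
  have "AE \<omega> in prb X. \<forall>k. wgt X (st X j \<omega>) k > 0 \<longrightarrow>
       q (Suc j) (st X j \<omega>) k = tr X (st X j \<omega>) k / growth X C j \<omega> k"
    using martingale_Sn_An_iff[OF q C int] mart by blast
  then show "AE \<omega> in prb X. \<forall>s. C j \<omega> $ s = D (st X j \<omega>) $ s * wealth X C j \<omega>"
    using a1_wealth_pos[OF C(2), of j]
  proof eventually_elim
    case (elim \<omega>)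
    let ?i = "st X j \<omega>" and ?Z = "wealth X C j \<omega>"
    have "((1 / ?Z) *\<^sub>R C j \<omega> - D ?i) \<bullet> exret X ?i l = 0" if l: "wgt X ?i l * tr X ?i l > 0" for l
    proof -
      have wt: "wgt X ?i l > 0" "tr X ?i l > 0"
        using l wgt_nonneg[of ?i l] tr_nonneg[of ?i l] by (auto simp: zero_less_mult_iff)
      have "q (Suc j) ?i l = tr X ?i l / growth X C j \<omega> l" using elim(1) wt(1) by blast
      then have "tr X ?i l / q (Suc j) ?i l = growth X C j \<omega> l" using wt(2) by simp
      moreover have "q (Suc j) ?i l = tr X ?i l / prop_growth D ?i l"
        using D(2) wt(1) unfolding i4_def by blast
      then have "tr X ?i l / q (Suc j) ?i l = prop_growth D ?i l" using wt(2) by simp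
      ultimately have "growth X C j \<omega> l = prop_growth D ?i l" by simp
      then show ?thesis by (simp add: growth_def inner_diff_left)
    qed
    then have "(1 / ?Z) *\<^sub>R C j \<omega> - D ?i = 0" using non unfolding nonredundant_def by blast
    then have "D ?i = (1 / ?Z) *\<^sub>R C j \<omega>" by simp
    then show ?case using elim(2) by simp
  qed
qed

section \<open>Optimal log-growth from a stationarity condition\<close>

text \<open>
  The condition on the series says that \<open>V\<close> is a critical point of the expected logarithm in the
  direction of \<open>U - V\<close>; by concavity of the logarithm it is then at least as good as \<open>U\<close>.
\<close>

lemma expected_log_mono:
  fixes U V :: "'w \<Rightarrow> 'm \<Rightarrow> real"
  assumes U [measurable]: "\<And>l. (\<lambda>\<omega>. U \<omega> l) \<in> borel_measurable (info X n)"
    and V [measurable]: "\<And>l. (\<lambda>\<omega>. V \<omega> l) \<in> borel_measurable (info X n)"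
    and pos: "AE \<omega> in prb X. \<forall>l. tr X (st X n \<omega>) l > 0 \<longrightarrow> U \<omega> l > 0 \<and> V \<omega> l > 0"
    and stat: "AE \<omega> in prb X. ((\<lambda>l. wgt X (st X n \<omega>) l * tr X (st X n \<omega>) l * ((U \<omega> l - V \<omega> l) / V \<omega> l)) has_sum 0) UNIV"
    and intU: "integrable (prb X) (\<lambda>\<omega>. wgt X (st X n \<omega>) (st X (Suc n) \<omega>) * ln (U \<omega> (st X (Suc n) \<omega>)))"
    and intV: "integrable (prb X) (\<lambda>\<omega>. wgt X (st X n \<omega>) (st X (Suc n) \<omega>) * ln (V \<omega> (st X (Suc n) \<omega>)))"
  shows "(\<integral>\<omega>. wgt X (st X n \<omega>) (st X (Suc n) \<omega>) * ln (U \<omega> (st X (Suc n) \<omega>)) \<partial>prb X)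
    \<le> (\<integral>\<omega>. wgt X (st X n \<omega>) (st X (Suc n) \<omega>) * ln (V \<omega> (st X (Suc n) \<omega>)) \<partial>prb X)"
proof -
  interpret F: sigma_finite_subalgebra "prb X" "info X n" by (rule cond_exp_info)
  let ?W = "\<lambda>\<omega> l. wgt X (st X n \<omega>) l * ln (U \<omega> l) - wgt X (st X n \<omega>) l * ln (V \<omega> l)"
  let ?c = "real_cond_exp (prb X) (info X n) (\<lambda>\<omega>. ?W \<omega> (st X (Suc n) \<omega>))"
  have int: "integrable (prb X) (\<lambda>\<omega>. ?W \<omega> (st X (Suc n) \<omega>))"
    by (rule Bochner_Integration.integrable_diff[OF intU intV])
  have "AE \<omega> in prb X. ((\<lambda>l. tr X (st X n \<omega>) l * ?W \<omega> l) has_sum ?c \<omega>) UNIV"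
    by (rule cond_exp_next[where U="?W", OF _ int]) measurable
  with pos stat have "AE \<omega> in prb X. ?c \<omega> \<le> 0"
  proof eventually_elim
    case (elim \<omega>)
    show ?case
    \<comment> \<open>Termwise, this is concavity of the logarithm: its graph lies below the tangent at \<open>V\<close>.\<close>
    proof (rule has_sum_mono[OF elim(3,2)])
      fix l
      show "tr X (st X n \<omega>) l * ?W \<omega> l
        \<le> wgt X (st X n \<omega>) l * tr X (st X n \<omega>) l * ((U \<omega> l - V \<omega> l) / V \<omega> l)"
      proof (cases "tr X (st X n \<omega>) l = 0")
        case False
        then have p: "U \<omega> l > 0" "V \<omega> l > 0" using elim(1) tr_nonneg by (auto simp: order_le_less)
        have "ln (U \<omega> l) - ln (V \<omega> l) \<le> (U \<omega> l - V \<omega> l) / V \<omega> l"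
          using ln_le_minus_one[of "U \<omega> l / V \<omega> l"] p by (simp add: ln_div diff_divide_distrib)
        from mult_left_mono[OF this, of "wgt X (st X n \<omega>) l * tr X (st X n \<omega>) l"]
        show ?thesis by (simp add: wgt_nonneg tr_nonneg algebra_simps)
      qed simp
    qed
  qed
  then have "(\<integral>\<omega>. ?c \<omega> \<partial>prb X) \<le> (\<integral>\<omega>. 0 \<partial>prb X)"
    using F.real_cond_exp_int(1)[OF int] by (intro integral_mono_AE) auto
  then have "(\<integral>\<omega>. ?W \<omega> (st X (Suc n) \<omega>) \<partial>prb X) \<le> 0"
    using F.real_cond_exp_int(2)[OF int] by simp
  then show ?thesis using intU intV by simp
qed

text \<open>
  The stationarity condition is required in each period for the strategy actually played; both ways
  to verify it, calibration and assetwise stationarity, end in this bound.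
\<close>

lemma Sn_le_En:
  assumes D: "i2 X D" "En_converges X n D"
    and C: "a0 X C" "a1 X C" "a2 X C" and int: "\<forall>m\<le>n. integrable (prb X) (Sn X C m)"
    and stat: "\<And>j. AE \<omega> in prb X. ((\<lambda>l. wgt X (st X j \<omega>) l * tr X (st X j \<omega>) l *
      ((growth X C j \<omega> l - prop_growth D (st X j \<omega>) l) / prop_growth D (st X j \<omega>) l)) has_sum 0) UNIV"
  shows "integral\<^sup>L (prb X) (Sn X C n) \<le> En X n D"
proof -
  have pos: "AE \<omega> in prb X. wealth X C j \<omega> > 0" for j by (rule a1_wealth_pos[OF C(2)])
  let ?g = "\<lambda>j \<omega>. wgt X (st X j \<omega>) (st X (Suc j) \<omega>) * ln (growth X C j \<omega> (st X (Suc j) \<omega>))"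
  have ig: "integrable (prb X) (?g j)" if "j < n" for j
    by (rule integrable_Sn_increment[OF C(1) pos]) (use int that in auto)
  have "integral\<^sup>L (prb X) (Sn X C n) = (\<integral>\<omega>. (\<Sum>j<n. ?g j \<omega>) \<partial>prb X)"
    by (rule integral_cong_AE[OF _ _ AE_Sn_sum[OF pos]])
      (use int ig in \<open>auto intro!: borel_measurable_sum intro: borel_measurable_integrable\<close>)
  also have "\<dots> = (\<Sum>j<n. integral\<^sup>L (prb X) (?g j))"
    using ig by (intro Bochner_Integration.integral_sum) auto
  also have "\<dots> \<le> (\<Sum>j<n. beta X D j)"
  proof (rule sum_mono)
    fix j assume "j \<in> {..<n}"
    then have j: "j < n" by simp
    show "integral\<^sup>L (prb X) (?g j) \<le> beta X D j"
      unfolding beta_def log_growth_def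
    proof (rule expected_log_mono[OF growth_measurable[OF C(1)] _ _ stat ig[OF j]])
      show "(\<lambda>\<omega>. prop_growth D (st X j \<omega>) l) \<in> borel_measurable (info X j)" for l by measurable
      show "AE \<omega> in prb X. \<forall>l. tr X (st X j \<omega>) l > 0 \<longrightarrow> growth X C j \<omega> l > 0 \<and> prop_growth D (st X j \<omega>) l > 0"
        using a2_growth_bound[OF C(1,3), of j]
        by eventually_elim (use prop_growth_pos[OF D(1)] lvl_pos in \<open>auto intro: less_le_trans\<close>)
      show "integrable (prb X) (\<lambda>\<omega>. wgt X (st X j \<omega>) (st X (Suc j) \<omega>) * ln (prop_growth D (st X j \<omega>) (st X (Suc j) \<omega>)))"
        using D(2) j by (simp add: En_converges_def log_growth_def[abs_def])
    qed
  qed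
  also have "\<dots> = En X n D" by (simp add: En_def sum.atLeast1_atMost_eq)
  finally show ?thesis .
qed

text \<open>
  Where \<open>\<phi> > 0\<close>, the formula \<open>q = p / r\<close> turns \<open>a3\<close> into the vanishing of
  \<open>\<Sum>l. \<phi> p (C \<bullet> g\<^sup>*) / r\<close>, and \<open>i3\<close> is the same statement for the fractions \<open>D\<close>.
\<close>

lemma Sn_le_En_calibrated:
  assumes D: "feasible X n D" "i4 X D q"
    and C: "a0 X C" "a1 X C" "a2 X C" "a3 X q C" and int: "\<forall>m\<le>n. integrable (prb X) (Sn X C m)"
  shows "integral\<^sup>L (prb X) (Sn X C n) \<le> En X n D"
proof (rule Sn_le_En[OF _ _ C(1-3) int])
  show D2: "i2 X D" and "En_converges X n D" using D(1) by (simp_all add: feasible_def)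
  fix j
  have a3: "AE \<omega> in prb X.
     ((\<lambda>l. wgt X (st X j \<omega>) l * q (Suc j) (st X j \<omega>) l * (C j \<omega> \<bullet> exret X (st X j \<omega>) l))
        has_sum 0) UNIV"
    using C(4) by (simp add: a3_def)
  show "AE \<omega> in prb X. ((\<lambda>l. wgt X (st X j \<omega>) l * tr X (st X j \<omega>) l *
      ((growth X C j \<omega> l - prop_growth D (st X j \<omega>) l) / prop_growth D (st X j \<omega>) l)) has_sum 0) UNIV"
    using a3
  proof eventually_elim
    case (elim \<omega>)
    let ?i = "st X j \<omega>" and ?Z = "wealth X C j \<omega>"
    let ?a = "\<lambda>l. 1 / ?Z * (wgt X ?i l * q (Suc j) ?i l * (C j \<omega> \<bullet> exret X ?i l))"
    let ?b = "\<lambda>l. wgt X ?i l * tr X ?i l * ((D ?i \<bullet> exret X ?i l) / prop_growth D ?i l)"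
    have "(?b has_sum 0) UNIV" using D(1) by (simp add: feasible_def i3_def)
    from has_sum_diff[OF has_sum_cmult_right[OF elim, of "1 / ?Z"] this]
    have "((\<lambda>l. ?a l - ?b l) has_sum 0) UNIV" by simp
    also have "(\<lambda>l. ?a l - ?b l) = (\<lambda>l. wgt X ?i l * tr X ?i l *
      ((growth X C j \<omega> l - prop_growth D ?i l) / prop_growth D ?i l))"
    proof
      fix l
      show "?a l - ?b l = wgt X ?i l * tr X ?i l * ((growth X C j \<omega> l - prop_growth D ?i l) / prop_growth D ?i l)"
      proof (cases "wgt X ?i l = 0")
        case False
        then have q: "q (Suc j) ?i l = tr X ?i l / prop_growth D ?i l"
          using D(2) wgt_nonneg[of ?i l] by (simp add: i4_def)
        show ?thesis unfolding q growth_def by (simp add: diff_divide_distrib right_diff_distrib)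
      qed simp
    qed
    finally show ?case .
  qed
qed

lemma portfolio_of_optimizer:
  assumes D: "optimizer X n D"
  shows "\<exists>C. proportional X D C \<and> a0 X C \<and> a1 X C \<and> a2 X C \<and> a2_null X C \<and>
    (\<forall>q. i4 X D q \<longrightarrow> a3 X q C) \<and> (\<forall>m\<le>n. integrable (prb X) (Sn X C m)) \<and>
    integral\<^sup>L (prb X) (Sn X C n) = En X n D"
proof -
  have D': "i1 X D" "i2 X D" "i3 X D" "En_converges X n D"
    using D by (simp_all add: optimizer_def feasible_def)
  obtain C where C: "proportional X D C" "a0 X C" "a1 X C" "a2 X C" "a2_null X C"
    "\<forall>m\<le>n. integrable (prb X) (Sn X C m)" "integral\<^sup>L (prb X) (Sn X C n) = En X n D"
    by (rule proportional_optimal_portfolio[OF D'(1,2,4)])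
  moreover have "\<forall>q. i4 X D q \<longrightarrow> a3 X q C"
    using proportional_a3[OF D'(2,3) _ C(1)] by blast
  ultimately show ?thesis by blast
qed

lemma Sn_le_optimum:
  assumes "optimizer X n Dst" "feasible X n D" "i4 X D q"
    and "a0 X C" "a1 X C" "a2 X C" "a3 X q C" "\<forall>m\<le>n. integrable (prb X) (Sn X C m)"
  shows "integral\<^sup>L (prb X) (Sn X C n) \<le> En X n Dst"
  using Sn_le_En_calibrated[OF assms(2-8)] assms(1,2) unfolding optimizer_def by fastforce

section \<open>Assetwise stationarity\<close>

text \<open>
  Condition \<open>i3A\<close> says that all partial derivatives of the expected logarithm with respect to the
  fractions vanish; the derivative in direction \<open>v\<close> is their linear combination.
\<close>

lemma i3A_stationary:
  assumes "i3A X D"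
  shows "((\<lambda>l. wgt X i l * tr X i l * ((v \<bullet> exret X i l) / prop_growth D i l)) has_sum 0) UNIV"
proof -
  let ?t = "\<lambda>s l. tr X i l * ((wgt X i l * exret X i l $ s) / prop_growth D i l)"
  have "((\<lambda>l. \<Sum>s\<in>S. v $ s * ?t s l) has_sum 0) UNIV" if "finite S" for S
    using that
  proof induction
    case (insert s S)
    have "(?t s has_sum 0) UNIV" using assms by (simp add: i3A_def)
    from has_sum_add[OF has_sum_cmult_right[OF this] insert.IH] insert.hyps show ?case by simp
  qed simp
  from this[of UNIV] have "((\<lambda>l. \<Sum>s\<in>UNIV. v $ s * ?t s l) has_sum 0) UNIV" by simp
  also have "(\<lambda>l. \<Sum>s\<in>UNIV. v $ s * ?t s l) = (\<lambda>l. wgt X i l * tr X i l * ((v \<bullet> exret X i l) / prop_growth D i l))"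
    by (simp add: inner_vec_def sum_distrib_left sum_divide_distrib mult_ac)
  finally show ?thesis .
qed

text \<open>
  This is strict concavity of the logarithm: the derivatives in direction \<open>D - D'\<close> vanish both at \<open>D\<close>
  and at \<open>D'\<close>, so the expected logarithm cannot be strictly concave between them.
\<close>

lemma i3A_unique_returns:
  assumes D: "i2 X D" "i3A X D" and D': "i2 X D'" "i3A X D'" and l: "wgt X i l * tr X i l > 0"
  shows "D i \<bullet> exret X i l = D' i \<bullet> exret X i l"
proof -
  let ?r = "prop_growth D i" and ?r' = "prop_growth D' i"
  let ?w = "\<lambda>l. wgt X i l * tr X i l"
  have pos: "?r l > 0" "?r' l > 0" for l using prop_growth_pos D(1) D'(1) by blast+
  have "((\<lambda>l. ?w l * (((D i - D' i) \<bullet> exret X i l) / ?r' l)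
      - ?w l * (((D i - D' i) \<bullet> exret X i l) / ?r l)) has_sum (0 - 0)) UNIV"
    by (intro has_sum_diff i3A_stationary D D')
  moreover have eq: "?w l * (((D i - D' i) \<bullet> exret X i l) / ?r' l) - ?w l * (((D i - D' i) \<bullet> exret X i l) / ?r l)
      = ?w l * (((D i - D' i) \<bullet> exret X i l)\<^sup>2 / (?r l * ?r' l))" for l
  proof -
    define d where "d = (D i - D' i) \<bullet> exret X i l"
    have "?r l - ?r' l = d" by (simp add: d_def inner_diff_left)
    then have "d / ?r' l - d / ?r l = d * d / (?r l * ?r' l)"
      using pos[of l] by (simp add: field_simps)
    then show ?thesis unfolding d_def[symmetric] by (simp only: power2_eq_square right_diff_distrib[symmetric])
  qed
  ultimately have sq: "((\<lambda>l. ?w l * (((D i - D' i) \<bullet> exret X i l)\<^sup>2 / (?r l * ?r' l))) has_sum 0) UNIV"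
    by simp
  have "?w l * (((D i - D' i) \<bullet> exret X i l)\<^sup>2 / (?r l * ?r' l)) = 0"
  proof (rule nonneg_has_sum_le_0D[OF sq order_refl])
    fix l show "?w l * (((D i - D' i) \<bullet> exret X i l)\<^sup>2 / (?r l * ?r' l)) \<ge> 0"
      using pos[of l] by (simp add: wgt_nonneg tr_nonneg)
  qed simp
  then show ?thesis using l pos[of l] by (auto simp: inner_diff_left)
qed

lemma Sn_le_En_i3A:
  assumes D: "i2 X D" "i3A X D" "En_converges X n D"
    and C: "a0 X C" "a1 X C" "a2 X C" and int: "\<forall>m\<le>n. integrable (prb X) (Sn X C m)"
  shows "integral\<^sup>L (prb X) (Sn X C n) \<le> En X n D"
proof (rule Sn_le_En[OF D(1,3) C int])
  fix j
  have "((\<lambda>l. wgt X (st X j \<omega>) l * tr X (st X j \<omega>) l *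
      ((growth X C j \<omega> l - prop_growth D (st X j \<omega>) l) / prop_growth D (st X j \<omega>) l)) has_sum 0) UNIV" for \<omega>
    using i3A_stationary[OF D(2), of "st X j \<omega>" "(1 / wealth X C j \<omega>) *\<^sub>R C j \<omega> - D (st X j \<omega>)"]
    by (simp add: growth_def inner_diff_left)
  then show "AE \<omega> in prb X. ((\<lambda>l. wgt X (st X j \<omega>) l * tr X (st X j \<omega>) l *
      ((growth X C j \<omega> l - prop_growth D (st X j \<omega>) l) / prop_growth D (st X j \<omega>) l)) has_sum 0) UNIV"
    by simp
qed

lemma beta_le_i3A:
  assumes D: "i2 X D" "i3A X D" "integrable (prb X) (log_growth X D j)"
    and D': "i2 X D'" "integrable (prb X) (log_growth X D' j)"
  shows "beta X D' j \<le> beta X D j"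
  unfolding beta_def log_growth_def
proof (rule expected_log_mono)
  show "integrable (prb X) (\<lambda>\<omega>. wgt X (st X j \<omega>) (st X (Suc j) \<omega>) * ln (prop_growth D (st X j \<omega>) (st X (Suc j) \<omega>)))"
    "integrable (prb X) (\<lambda>\<omega>. wgt X (st X j \<omega>) (st X (Suc j) \<omega>) * ln (prop_growth D' (st X j \<omega>) (st X (Suc j) \<omega>)))"
    using D(3) D'(2) by (simp_all add: log_growth_def[abs_def])
  show "AE \<omega> in prb X. \<forall>l. tr X (st X j \<omega>) l > 0 \<longrightarrow>
      prop_growth D' (st X j \<omega>) l > 0 \<and> prop_growth D (st X j \<omega>) l > 0"
    using prop_growth_pos D(1) D'(1) by simp
  have "((\<lambda>l. wgt X i l * tr X i l *
      ((prop_growth D' i l - prop_growth D i l) / prop_growth D i l)) has_sum 0) UNIV" for i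
    using i3A_stationary[OF D(2), of i "D' i - D i"] by (simp add: inner_diff_left)
  then show "AE \<omega> in prb X. ((\<lambda>l. wgt X (st X j \<omega>) l * tr X (st X j \<omega>) l *
      ((prop_growth D' (st X j \<omega>) l - prop_growth D (st X j \<omega>) l) / prop_growth D (st X j \<omega>) l)) has_sum 0) UNIV"
    by simp
qed measurable

lemma i3A_unique:
  assumes D: "i2 X D" "i3A X D" "i2 X D'" "i3A X D'" and non: "nonredundant X"
  shows "D' = D"
proof
  fix i
  have "(D' i - D i) \<bullet> exret X i l = 0" if "wgt X i l * tr X i l > 0" for l
    using i3A_unique_returns[OF D that] by (simp add: inner_diff_left)
  then have "D' i - D i = 0" using non unfolding nonredundant_def by blast
  then show "D' i = D i" by simp
qed

lemma i3A_optimal: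
  assumes D: "i1 X D" "i2 X D" "i3A X D" "En_converges X n D"
  shows "\<exists>C. proportional X D C \<and> a0 X C \<and> a1 X C \<and> a2 X C \<and> a2_null X C \<and>
    (\<forall>m\<le>n. integrable (prb X) (Sn X C m)) \<and>
    integral\<^sup>L (prb X) (Sn X C n) = En X n D \<and>
    (\<forall>C'. a0 X C' \<and> a1 X C' \<and> a2 X C' \<and> (\<forall>m\<le>n. integrable (prb X) (Sn X C' m)) \<longrightarrow>
       integral\<^sup>L (prb X) (Sn X C' n) \<le> integral\<^sup>L (prb X) (Sn X C n))"
proof -
  obtain C where C: "proportional X D C" "a0 X C" "a1 X C" "a2 X C" "a2_null X C"
    "\<forall>m\<le>n. integrable (prb X) (Sn X C m)" "integral\<^sup>L (prb X) (Sn X C n) = En X n D"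
    by (rule proportional_optimal_portfolio[OF D(1,2,4)])
  have "integral\<^sup>L (prb X) (Sn X C' n) \<le> integral\<^sup>L (prb X) (Sn X C n)"
    if "a0 X C'" "a1 X C'" "a2 X C'" "\<forall>m\<le>n. integrable (prb X) (Sn X C' m)" for C'
    unfolding C(7) by (rule Sn_le_En_i3A[OF D(2-4) that])
  with C show ?thesis by blast
qed

end

section \<open>Optimality and the martingale criterion\<close>

(* The conjuncts are, in order: (a); the "if" part of (b); a criterion for the martingale property
   in terms of the random fractions C_j / Z_j, valid for arbitrary calibrating functions; the
   equivalence of (b); (c); (d). *)

theorem theorem3p2:
  fixes X :: "('w, 'm::countable, 'k::finite) market"
  assumes market: "markov_market X"
  shows "(\<forall>q C. calibrating X q \<and> a0 X C \<and> a1 X C \<and> a2 X C \<and> a2_null X C \<and> a3 X q C \<and>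
           (\<forall>n. integrable (prb X) (Sn X C n)) \<longrightarrow>
        supermartingale (prb X) (info X) (\<lambda>n \<omega>. Sn X C n \<omega> - An X q n \<omega>) \<and>
        (\<forall>n\<ge>1. integral\<^sup>L (prb X) (Sn X C n) \<le> integral\<^sup>L (prb X) (An X q n))) \<and>
    (\<forall>q C D. calibrating X q \<and> a0 X C \<and> (\<forall>n. integrable (prb X) (Sn X C n)) \<and>
           i1 X D \<and> i2 X D \<and> i3 X D \<and> i4 X D q \<and> proportional X D C \<longrightarrow>
        a1 X C \<and> a2 X C \<and> a2_null X C \<and> a3 X q C \<and>
        martingale (prb X) (info X) (\<lambda>n \<omega>. Sn X C n \<omega> - An X q n \<omega>) \<and>
        (\<forall>n\<ge>1. integral\<^sup>L (prb X) (Sn X C n)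
           = (\<Sum>j=1..n. integral\<^sup>L (prb X) (\<lambda>\<omega>. alpha X q (j - 1) (st X (j - 1) \<omega>))))) \<and>
    (\<forall>q C. calibrating X q \<and> a0 X C \<and> a1 X C \<and> a2 X C \<and> a2_null X C \<and> a3 X q C \<and>
           (\<forall>n. integrable (prb X) (Sn X C n)) \<longrightarrow>
        (martingale (prb X) (info X) (\<lambda>n \<omega>. Sn X C n \<omega> - An X q n \<omega>) \<longleftrightarrow>
         (\<forall>j. AE \<omega> in prb X. \<forall>k. wgt X (st X j \<omega>) k > 0 \<longrightarrow>
            q (Suc j) (st X j \<omega>) k = tr X (st X j \<omega>) k /
              (1 + rate X + (C j \<omega> \<bullet> exret X (st X j \<omega>) k) / wealth X C j \<omega>)))) \<and>
    (\<forall>q C. all_states_visited X \<and> calibrating X q \<and> (\<forall>j. q j = q 0) \<and>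
           a0 X C \<and> (\<forall>n. integrable (prb X) (Sn X C n)) \<longrightarrow>
        (a1 X C \<and> a2 X C \<and> a2_null X C \<and> a3 X q C \<and>
           martingale (prb X) (info X) (\<lambda>n \<omega>. Sn X C n \<omega> - An X q n \<omega>) \<longrightarrow>
         (\<exists>D. i1 X D \<and> i2 X D \<and> i3 X D \<and> i4 X D q)) \<and>
        (nonredundant X \<longrightarrow>
          ((a1 X C \<and> a2 X C \<and> a2_null X C \<and> a3 X q C \<and>
            martingale (prb X) (info X) (\<lambda>n \<omega>. Sn X C n \<omega> - An X q n \<omega>)) \<longleftrightarrow>
           (\<exists>D. i1 X D \<and> i2 X D \<and> i3 X D \<and> i4 X D q \<and> proportional X D C)))) \<and>
    (\<forall>n\<ge>1. \<forall>Dst. optimizer X n Dst \<longrightarrow>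
        (\<exists>C. proportional X Dst C \<and> a0 X C \<and> a1 X C \<and> a2 X C \<and> a2_null X C \<and>
             (\<forall>q. i4 X Dst q \<longrightarrow> a3 X q C) \<and>
             (\<forall>m\<le>n. integrable (prb X) (Sn X C m)) \<and>
             integral\<^sup>L (prb X) (Sn X C n) = En X n Dst) \<and>
        (\<forall>D q C. feasible X n D \<and> i4 X D q \<and>
             a0 X C \<and> a1 X C \<and> a2 X C \<and> a3 X q C \<and>
             (\<forall>m\<le>n. integrable (prb X) (Sn X C m)) \<longrightarrow>
           integral\<^sup>L (prb X) (Sn X C n) \<le> En X n Dst)) \<and>
    (\<forall>Dst. (\<forall>i s. Dst i $ s > 0) \<and> i1 X Dst \<and> i2 X Dst \<and> i3A X Dst \<longrightarrow>
        (\<forall>D. (\<forall>i s. D i $ s > 0) \<and> i1 X D \<and> i2 X D \<and> i3A X D \<longrightarrow>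
           (\<forall>i l. wgt X i l * tr X i l > 0 \<longrightarrow> D i \<bullet> exret X i l = Dst i \<bullet> exret X i l) \<and>
           (nonredundant X \<longrightarrow> D = Dst)) \<and>
        (\<forall>n\<ge>1. En_converges X n Dst \<longrightarrow>
           (\<forall>j\<in>{1..n}. \<forall>D. i1 X D \<and> i2 X D \<and> integrable (prb X) (log_growth X D (j - 1)) \<longrightarrow>
              beta X D (j - 1) \<le> beta X Dst (j - 1)) \<and>
           (\<exists>C. proportional X Dst C \<and> a0 X C \<and> a1 X C \<and> a2 X C \<and> a2_null X C \<and>
              (\<forall>m\<le>n. integrable (prb X) (Sn X C m)) \<and>
              integral\<^sup>L (prb X) (Sn X C n) = En X n Dst \<and>
              (\<forall>C'. a0 X C' \<and> a1 X C' \<and> a2 X C' \<and>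
                 (\<forall>m\<le>n. integrable (prb X) (Sn X C' m)) \<longrightarrow>
                 integral\<^sup>L (prb X) (Sn X C' n) \<le> integral\<^sup>L (prb X) (Sn X C n)))))"
proof -
  interpret market_model X by unfold_locales (rule market)
  show ?thesis
    apply (intro conjI; intro allI impI)
    subgoal for q C
      using supermartingale_Sn_An[of q C] supermartingale_expectation[of C q] by blast
    subgoal for q C D
      using proportional_admissible[of D C] proportional_a3[of D q C]
        proportional_martingale[of q C D] martingale_expectation[of C q] by blast
    subgoal for q C
      using martingale_Sn_An_iff[of q C] unfolding growth_def by blast
    subgoal for q C
      using martingale_fractions[of q C] martingale_imp_proportional[of q _ C]
        proportional_admissible[of _ C] proportional_a3[of _ q C] proportional_martingale[of q C]
      by (intro conjI impI iffI) metis+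
    subgoal for n D
      using portfolio_of_optimizer[of n D] Sn_le_optimum[of n D] by metis
    subgoal for D
    proof (intro conjI allI impI ballI; (elim conjE)?)
      fix D' i l assume "i2 X D" "i3A X D" "i2 X D'" "i3A X D'" "wgt X i l * tr X i l > 0"
      then show "D' i \<bullet> exret X i l = D i \<bullet> exret X i l" using i3A_unique_returns[of D' D i l] by blast
    next
      fix D' assume "i2 X D" "i3A X D" "i2 X D'" "i3A X D'" "nonredundant X"
      then show "D' = D" using i3A_unique[of D D'] by blast
    next
      fix n j D' assume "En_converges X n D" "j \<in> {1..n}" "i2 X D" "i3A X D" "i2 X D'"
        "integrable (prb X) (log_growth X D' (j - 1))"
      then show "beta X D' (j - 1) \<le> beta X D (j - 1)"
        by (intro beta_le_i3A) (auto simp: En_converges_def)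
    next
      fix n assume "i1 X D" "i2 X D" "i3A X D" "En_converges X n D"
      then show "\<exists>C. proportional X D C \<and> a0 X C \<and> a1 X C \<and> a2 X C \<and> a2_null X C \<and>
        (\<forall>m\<le>n. integrable (prb X) (Sn X C m)) \<and>
        integral\<^sup>L (prb X) (Sn X C n) = En X n D \<and>
        (\<forall>C'. a0 X C' \<and> a1 X C' \<and> a2 X C' \<and> (\<forall>m\<le>n. integrable (prb X) (Sn X C' m)) \<longrightarrow>
          integral\<^sup>L (prb X) (Sn X C' n) \<le> integral\<^sup>L (prb X) (Sn X C n))"
        by (rule i3A_optimal)
    qed
    done
qed

end
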